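(* Let $N>1$ and $\phi=\frac{\pi}{2}+2\arcsin\left(\frac{1}{2N}\right)$. There exists a constant $c(\phi)$, depending only on $\phi$, such that the following holds for every $R>0$ and every $x_0\in\mathbb{R}^2$. Let $g\colon[a,b]\to\mathbb{R}^2$ be an injective $R$-path with $g([a,b])\subseteq D\left(x_0,\frac{R}{2N}\right)$. Then $g$ is a rectifiable curve and $$\mathrm{length}(g)\le \frac{\mathrm{per}(\mathrm{co}(g([a,b])))}{1+\cos\phi}.$$ Moreover, for all $a\le t_1<t_2\le b$, with $x_i=g(t_i)$, $$\frac{\mathrm{length}(g|_{[t_1,t_2]})}{|x_1-x_2|}\le c(\phi).$$
   Context: Notation: $B(z,\rho)$ is the open disk in $\mathbb{R}^2$ of center $z$ and radius $\rho$, $D(z,\rho)$ its closure, $\mathbb{S}^1$ the unit circle, $\mathrm{co}(S)$ the convex hull of $S$, and $\mathrm{per}(K)$ the perimeter of a convex set $K$ (twice the length if $K$ is a segment). For a nonempty closed set $K\subset\mathbb{R}^2$ and $q\in K$, the tangent cone is $$\mathrm{Tan}(K,q)=\{v\in\mathbb{R}^2:\forall\varepsilon>0\ \exists x\in K,\ r>0\text{ with }|x-q|<\varepsilon,\ |r(x-q)-v|<\varepsilon\}.$$ $R$-path: let $R>0$. A continuous map $g\colon[a,b]\to\mathbb{R}^2$ with $g(a)\ne g(b)$ is an $R$-path if for every $t\in[a,b]$, writing $x=g(t)$, and for every unit vector $l\in\big[-\mathrm{Tan}(g([a,t]),x)\big]\cup\mathrm{Tan}(g([t,b]),x)$, one has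 $g([a,t])\cap B(x+Rl,R)=\varnothing$. *)

theory Defs
  imports "HOL-Analysis.Analysis"
begin

definition tangent_cone :: "'a::real_normed_vector set \<Rightarrow> 'a \<Rightarrow> 'a set" where
  "tangent_cone K q =
     {v. \<forall>\<epsilon>>0. \<exists>x\<in>K. \<exists>r>0. norm (x - q) < \<epsilon> \<and> norm (r *\<^sub>R (x - q) - v) < \<epsilon>}"

definition R_path :: "real \<Rightarrow> (real \<Rightarrow> 'a::real_normed_vector) \<Rightarrow> real \<Rightarrow> real \<Rightarrow> bool" where
  "R_path R g a b \<longleftrightarrow>
     a < b \<and> continuous_on {a..b} g \<and> g a \<noteq> g b \<and>
     (\<forall>t\<in>{a..b}. \<forall>l \<in> uminus ` tangent_cone (g ` {a..t}) (g t) \<union> tangent_cone (g ` {t..b}) (g t).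
        norm l = 1 \<longrightarrow> g ` {a..t} \<inter> ball (g t + R *\<^sub>R l) R = {})"

definition curve_length :: "(real \<Rightarrow> 'a::metric_space) \<Rightarrow> real \<Rightarrow> real \<Rightarrow> ennreal" where
  "curve_length g a b =
     (SUP (n, t) \<in> {(n :: nat, t). mono_on {..n} t \<and> t 0 = a \<and> t n = b}.
        ennreal (\<Sum>i<n. dist (g (t i)) (g (t (Suc i)))))"

definition rectifiable_curve :: "(real \<Rightarrow> 'a::metric_space) \<Rightarrow> real \<Rightarrow> real \<Rightarrow> bool" where
  "rectifiable_curve g a b \<longleftrightarrow> continuous_on {a..b} g \<and> curve_length g a b < \<infinity>"

text \<open>Meant for nonempty compact convex sets in the plane. If the interior is empty, the set is a
  segment (possibly a point), whose length is its diameter. Otherwise the frontier is a Jordan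
  curve, and the perimeter is its length. This does not depend on the simple closed
  parametrization chosen.\<close>
definition perimeter :: "(real ^ 2) set \<Rightarrow> ennreal" where
  "perimeter K =
     (if interior K = {} then ennreal (2 * diameter K)
      else curve_length
        (SOME \<gamma>. simple_path \<gamma> \<and> pathfinish \<gamma> = pathstart \<gamma> \<and> path_image \<gamma> = frontier K) 0 1)"

end

theory Submission
  imports Defs
begin

text \<open>
  Put \<open>\<sigma> = 1 / (2 * N)\<close> and \<open>\<beta> = arcsin \<sigma> < pi / 6\<close>. The ball condition and the diameter bound force
  every forward tangent direction at \<open>x = g t\<close> to make an angle at least \<open>pi / 2 - \<beta>\<close> with all
  directions to past points. The angle under which two past points are seen from \<open>x\<close> starts at
  most \<open>pi / 2 + \<beta>\<close> and decreases whenever it lies between \<open>pi / 2 + \<beta>\<close> and \<open>pi - 2 * \<beta>\<close>, so it never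
  exceeds \<open>pi / 2 + \<beta> < 2 * pi / 3\<close>. Hence the past lies in a sector of that opening, and the arc of
  normal directions at \<open>x\<close> is long enough for Cauchy's perimeter integral of the past to grow at
  rate at least \<open>1 - \<sigma> > 1 + cos \<phi>\<close> with respect to distance. Telescoping bounds the length.
  The ball condition also bounds the decay of the logarithmic distance to the initial point by the
  length travelled, which makes all distances to the initial point comparable to the chord.
\<close>

section \<open>Directions and support functions\<close>

text \<open>No derivative of the curve is available, and the perimeter of the past is only known to
  be nondecreasing. Differential inequalities are therefore one-sided: they are tested on limit
  directions of secants to the right, by a differentiable function that may depend on the direction,
  and made global by a supremum argument that tolerates upward jumps. The test needs a strict
  inequality, so growth is shown for every rate below \<open>1 - \<sigma>\<close>; the claimed rate
  is one of these because \<open>cos \<phi> = - 2 * \<sigma> * sqrt (1 - \<sigma>\<^sup>2)\<close>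
  and the root exceeds 1/2.

  The hypothesis \<open>N > 1\<close> amounts to \<open>pi / 2 + \<beta> < pi - 2 * \<beta>\<close>:
  the range in which the angle decreases is a nonempty barrier, which a continuous angle cannot
  cross. In the chord estimate a rate \<open>1 / R\<close> meets a perimeter of order
  \<open>R\<close>, so \<open>R\<close> cancels from the constant.\<close>

definition dirv :: "real \<Rightarrow> real ^ 2" where
  "dirv \<theta> = vector [cos \<theta>, sin \<theta>]"

lemma dirv_nth [simp]: "dirv \<theta> $ 1 = cos \<theta>" "dirv \<theta> $ 2 = sin \<theta>"
  by (simp_all add: dirv_def)

lemma inner_dirv: "v \<bullet> dirv \<theta> = v $ 1 * cos \<theta> + v $ 2 * sin \<theta>"
  by (simp add: inner_vec_def sum_2 dirv_def)

lemma norm_dirv [simp]: "norm (dirv \<theta>) = 1"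
  by (simp add: norm_eq_sqrt_inner inner_vec_def sum_2 dirv_def flip: power2_eq_square)

lemma dirv_inner_dirv: "dirv \<alpha> \<bullet> dirv \<beta> = cos (\<alpha> - \<beta>)"
  by (simp add: inner_dirv cos_diff)

lemma dirv_periodic: "dirv (\<theta> + 2 * pi) = dirv \<theta>"
  by (simp add: dirv_def)

lemma dirv_plus_pi: "dirv (\<theta> + pi) = - dirv \<theta>"
  by (simp add: dirv_def vec_eq_iff forall_2)

lemma continuous_on_dirv: "continuous_on A dirv"
proof -
  have "continuous_on A (\<lambda>\<theta>. \<chi> i. dirv \<theta> $ i)"
  proof (intro continuous_on_vec_lambda)
    fix i :: 2
    show "continuous_on A (\<lambda>\<theta>. dirv \<theta> $ i)"
      using exhaust_2[of i] by (elim disjE) (simp_all add: continuous_on_cos continuous_on_sin continuous_on_id)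
  qed
  then show ?thesis by simp
qed

lemma unit_vector_dirv:
  fixes v :: "real ^ 2"
  assumes "norm v = 1"
  obtains \<theta> where "0 \<le> \<theta>" "\<theta> < 2 * pi" "v = dirv \<theta>"
proof -
  have "(v $ 1)\<^sup>2 + (v $ 2)\<^sup>2 = 1"
    using assms by (simp add: norm_eq_sqrt_inner inner_vec_def sum_2 power2_eq_square)
  then obtain \<theta> where "0 \<le> \<theta>" "\<theta> < 2 * pi" "v $ 1 = cos \<theta>" "v $ 2 = sin \<theta>"
    using sincos_total_2pi by blast
  with that show thesis by (simp add: dirv_def vec_eq_iff forall_2)
qed

lemma has_integral_inner_dirv:
  assumes "p \<le> q"
  shows "((\<lambda>\<theta>. v \<bullet> dirv \<theta>) has_integral
    v $ 1 * (sin q - sin p) + v $ 2 * (cos p - cos q)) {p..q}"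
proof -
  have "((\<lambda>\<theta>. v \<bullet> dirv \<theta>) has_integral
    (v $ 1 * sin q - v $ 2 * cos q) - (v $ 1 * sin p - v $ 2 * cos p)) {p..q}"
    unfolding inner_dirv
    by (intro fundamental_theorem_of_calculus assms)
      (auto intro!: derivative_eq_intros simp flip: has_real_derivative_iff_has_vector_derivative)
  then show ?thesis by (simp add: algebra_simps)
qed

lemma integral_inner_dirv_period: "integral {0..2 * pi} (\<lambda>\<theta>. v \<bullet> dirv \<theta>) = 0"
  using has_integral_inner_dirv[of 0 "2 * pi" v] by (simp add: integral_unique)

lemma integral_full_period:
  fixes f :: "real \<Rightarrow> real"
  assumes cont: "continuous_on UNIV f" and per: "\<And>x. f (x + 2 * pi) = f x"
  shows "integral {c..c + 2 * pi} f = integral {0..2 * pi} f"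
proof -
  have int: "f integrable_on {u..v}" for u v
    using cont by (intro integrable_continuous_real) (auto intro: continuous_on_subset)
  have shift: "integral {u + 2 * pi..v + 2 * pi} f = integral {u..v} f" for u v
    using integral_shift[of u "2 * pi" v f] continuous_on_subset[OF cont]
    by (simp add: o_def per)
  have split: "integral {u..v} f + integral {v..w} f = integral {u..w} f"
    if "u \<le> v" "v \<le> w" for u v w
    using that int by (intro Henstock_Kurzweil_Integration.integral_combine) auto
  show ?thesis
  proof (cases "c \<le> 0")
    case True
    define d where "d = min c (- 2 * pi)"
    have "integral {d..c} f + integral {c..c + 2 * pi} f = integral {d..c + 2 * pi} f"
      by (rule split) (use True in \<open>auto simp: d_def min_def\<close>)
    moreover have "integral {d..d + 2 * pi} f + integral {d + 2 * pi..c + 2 * pi} f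
        = integral {d..c + 2 * pi} f"
      by (rule split) (use True in \<open>auto simp: d_def min_def\<close>)
    moreover have "integral {d..0} f + integral {0..2 * pi} f = integral {d..2 * pi} f"
      by (rule split) (use True in \<open>auto simp: d_def min_def\<close>)
    moreover have "integral {d..d + 2 * pi} f + integral {d + 2 * pi..0 + 2 * pi} f
        = integral {d..0 + 2 * pi} f"
      by (rule split) (use True in \<open>auto simp: d_def min_def\<close>)
    ultimately show ?thesis using shift[of d c] shift[of d 0] by simp
  next
    case False
    then have "integral {0..c} f + integral {c..c + 2 * pi} f = integral {0..c + 2 * pi} f"
      "integral {0..2 * pi} f + integral {0 + 2 * pi..c + 2 * pi} f = integral {0..c + 2 * pi} f"
      using split[of 0 c "c + 2 * pi"] split[of 0 "2 * pi" "c + 2 * pi"] by auto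
    then show ?thesis using shift[of 0 c] by simp
  qed
qed

lemma integrable_abs_inner_dirv: "(\<lambda>\<theta>. \<bar>v \<bullet> dirv \<theta>\<bar>) integrable_on {p..q}"
  by (intro integrable_continuous_real continuous_on_rabs continuous_on_inner
      continuous_on_const continuous_on_dirv)

text \<open>The constant in Crofton's formula: the cosine is nonnegative on the half period centred
  at the direction of \<open>v\<close> and nonpositive on the other, and each half contributes
  \<open>2 * norm v\<close>.\<close>

lemma integral_abs_inner_dirv: "integral {0..2 * pi} (\<lambda>\<theta>. \<bar>v \<bullet> dirv \<theta>\<bar>) = 4 * norm v"
proof (cases "v = 0")
  case False
  define w where "w = (1 / norm v) *\<^sub>R v"
  have "norm w = 1" using False by (simp add: w_def)
  then obtain \<alpha> where \<alpha>: "w = dirv \<alpha>" by (rule unit_vector_dirv)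
  have v: "v = norm v *\<^sub>R dirv \<alpha>"
    using False by (simp add: w_def flip: \<alpha>)
  define f where "f = (\<lambda>\<theta>. \<bar>v \<bullet> dirv \<theta>\<bar>)"
  have f: "f \<theta> = norm v * \<bar>cos (\<theta> - \<alpha>)\<bar>" for \<theta>
    unfolding f_def by (subst v) (simp add: dirv_inner_dirv abs_mult cos_diff mult.commute)
  have cont: "continuous_on A f" for A
    unfolding f by (intro continuous_intros)
  have F1: "((\<lambda>\<theta>. norm v * cos (\<theta> - \<alpha>)) has_integral norm v * sin (pi / 2) - norm v * sin (- (pi / 2)))
      {\<alpha> - pi / 2..\<alpha> + pi / 2}"
  proof -
    have "((\<lambda>\<theta>. norm v * cos (\<theta> - \<alpha>)) has_integral norm v * sin (\<alpha> + pi / 2 - \<alpha>) - norm v * sin (\<alpha> - pi / 2 - \<alpha>))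
      {\<alpha> - pi / 2..\<alpha> + pi / 2}"
      by (intro fundamental_theorem_of_calculus)
        (auto intro!: derivative_eq_intros simp flip: has_real_derivative_iff_has_vector_derivative)
    then show ?thesis by simp
  qed
  have F2: "((\<lambda>\<theta>. - (norm v * cos (\<theta> - \<alpha>))) has_integral 2 * norm v)
      {\<alpha> + pi / 2..\<alpha> + 3 * pi / 2}"
  proof -
    have "((\<lambda>\<theta>. - (norm v * cos (\<theta> - \<alpha>))) has_integral (- norm v * sin (\<alpha> + 3 * pi / 2 - \<alpha>)) - (- norm v * sin (\<alpha> + pi / 2 - \<alpha>)))
      {\<alpha> + pi / 2..\<alpha> + 3 * pi / 2}"
      by (intro fundamental_theorem_of_calculus)
        (auto intro!: derivative_eq_intros simp flip: has_real_derivative_iff_has_vector_derivative)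
    moreover have "sin (3 * pi / 2) = -1" using sin_3over2_pi by simp
    ultimately show ?thesis by simp
  qed
  have "integral {\<alpha> - pi / 2..\<alpha> + pi / 2} f = 2 * norm v"
  proof -
    have "(f has_integral norm v * sin (pi / 2) - norm v * sin (- (pi / 2))) {\<alpha> - pi / 2..\<alpha> + pi / 2}"
    proof (rule has_integral_eq[OF _ F1])
      fix \<theta> assume "\<theta> \<in> {\<alpha> - pi / 2..\<alpha> + pi / 2}"
      then have "0 \<le> cos (\<theta> - \<alpha>)" by (intro cos_ge_zero) auto
      then show "norm v * cos (\<theta> - \<alpha>) = f \<theta>" by (simp add: f)
    qed
    then show ?thesis by (simp add: integral_unique)
  qed
  moreover have "integral {\<alpha> + pi / 2..\<alpha> + 3 * pi / 2} f = 2 * norm v"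
  proof -
    have "cos (\<theta> - \<alpha>) \<le> 0" if "\<theta> \<in> {\<alpha> + pi / 2..\<alpha> + 3 * pi / 2}" for \<theta>
    proof -
      have "0 \<le> cos (\<theta> - \<alpha> - pi)" using that by (intro cos_ge_zero) auto
      then show ?thesis by (simp add: cos_diff)
    qed
    then have "(f has_integral 2 * norm v) {\<alpha> + pi / 2..\<alpha> + 3 * pi / 2}"
      by (intro has_integral_eq[OF _ F2]) (auto simp: f)
    then show ?thesis by (simp add: integral_unique)
  qed
  moreover have "integral {\<alpha> - pi / 2..\<alpha> + pi / 2} f + integral {\<alpha> + pi / 2..\<alpha> + 3 * pi / 2} f
      = integral {\<alpha> - pi / 2..\<alpha> + 3 * pi / 2} f"
    using cont by (intro Henstock_Kurzweil_Integration.integral_combine integrable_continuous_real) auto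
  moreover have "integral {\<alpha> - pi / 2..\<alpha> - pi / 2 + 2 * pi} f = integral {0..2 * pi} f"
    by (rule integral_full_period[OF cont]) (simp add: f_def dirv_periodic)
  ultimately show ?thesis by (simp add: f_def field_simps)
qed simp

section \<open>Support functions and Cauchy's perimeter integral\<close>

definition support :: "'a::real_inner set \<Rightarrow> 'a \<Rightarrow> real" where
  "support S v = (SUP x\<in>S. x \<bullet> v)"

lemma bdd_above_inner: "bounded S \<Longrightarrow> bdd_above ((\<lambda>x. x \<bullet> v) ` S)"
  by (intro bounded_imp_bdd_above bounded_linear_image bounded_linear_inner_left)

lemma support_upper: "bounded S \<Longrightarrow> x \<in> S \<Longrightarrow> x \<bullet> v \<le> support S v"
  unfolding support_def by (rule cSUP_upper) (auto simp: bdd_above_inner)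

lemma support_least: "S \<noteq> {} \<Longrightarrow> (\<And>x. x \<in> S \<Longrightarrow> x \<bullet> v \<le> c) \<Longrightarrow> support S v \<le> c"
  unfolding support_def by (rule cSUP_least)

lemma support_mono: "bounded T \<Longrightarrow> S \<subseteq> T \<Longrightarrow> S \<noteq> {} \<Longrightarrow> support S v \<le> support T v"
  by (intro support_least support_upper) auto

lemma support_convex_hull:
  assumes "bounded S" "S \<noteq> {}"
  shows "support (convex hull S) v = support S v"
proof (rule antisym)
  have "convex hull S \<subseteq> {x. v \<bullet> x \<le> support S v}"
    using assms by (intro hull_minimal convex_halfspace_le) (auto simp: support_upper inner_commute)
  then show "support (convex hull S) v \<le> support S v"
    using assms by (intro support_least) (auto simp: inner_commute)
next
  show "support S v \<le> support (convex hull S) v"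
    using assms by (intro support_mono bounded_convex_hull hull_subset)
qed

lemma continuous_on_support:
  assumes "bounded S" "S \<noteq> {}"
  shows "continuous_on A (support S)"
proof -
  obtain B where B: "\<And>x. x \<in> S \<Longrightarrow> norm x \<le> B" using assms(1) bounded_iff by blast
  have half: "support S v \<le> support S w + B * norm (v - w)" for v w
  proof (rule support_least[OF assms(2)])
    fix x assume x: "x \<in> S"
    have "x \<bullet> v = x \<bullet> w + x \<bullet> (v - w)" by (simp add: inner_diff_right)
    also have "x \<bullet> (v - w) \<le> norm x * norm (v - w)" by (rule norm_cauchy_schwarz)
    also have "\<dots> \<le> B * norm (v - w)" using B[OF x] by (rule mult_right_mono) simp
    also have "x \<bullet> w \<le> support S w" using assms x by (simp add: support_upper)
    finally show "x \<bullet> v \<le> support S w + B * norm (v - w)" by simp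
  qed
  have "0 \<le> B" using assms(2) B norm_ge_zero order_trans by blast
  have "B-lipschitz_on A (support S)"
  proof (rule lipschitz_onI[OF _ \<open>0 \<le> B\<close>])
    fix v w show "dist (support S v) (support S w) \<le> B * dist v w"
      using half[of v w] half[of w v] by (auto simp: dist_norm norm_minus_commute)
  qed
  then show ?thesis by (rule lipschitz_on_continuous_on)
qed

text \<open>By Cauchy's formula this is the perimeter of the convex hull of \<open>S\<close>.\<close>
definition cauchy_perimeter :: "(real ^ 2) set \<Rightarrow> real" where
  "cauchy_perimeter S = integral {0..2 * pi} (\<lambda>\<theta>. support S (dirv \<theta>))"

lemma continuous_on_support_dirv:
  assumes "bounded S" "S \<noteq> {}"
  shows "continuous_on A (\<lambda>\<theta>. support S (dirv \<theta>))"
  by (rule continuous_on_compose2[OF continuous_on_support[OF assms, of UNIV] continuous_on_dirv]) simp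

lemma integrable_support_dirv:
  assumes "bounded S" "S \<noteq> {}"
  shows "(\<lambda>\<theta>. support S (dirv \<theta>)) integrable_on {p..q}"
  using continuous_on_support_dirv[OF assms] by (rule integrable_continuous_real)

lemma continuous_on_support_minus_dirv:
  assumes "bounded S" "S \<noteq> {}"
  shows "continuous_on A (\<lambda>\<theta>. support S (- dirv \<theta>))"
  by (rule continuous_on_compose2[OF continuous_on_support[OF assms, of UNIV]
        continuous_on_minus[OF continuous_on_dirv]]) simp

lemma integrable_width:
  assumes "bounded S" "S \<noteq> {}"
  shows "(\<lambda>\<theta>. support S (dirv \<theta>) + support S (- dirv \<theta>)) integrable_on {p..q}"
  using assms by (intro integrable_continuous_real continuous_on_add
      continuous_on_support_dirv continuous_on_support_minus_dirv)

lemma cauchy_perimeter_period: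
  assumes "bounded S" "S \<noteq> {}"
  shows "cauchy_perimeter S = integral {c..c + 2 * pi} (\<lambda>\<theta>. support S (dirv \<theta>))"
  unfolding cauchy_perimeter_def
  by (rule integral_full_period[symmetric]) (auto simp: dirv_periodic assms continuous_on_support_dirv)

lemma cauchy_perimeter_mono:
  assumes "bounded T" "S \<subseteq> T" "S \<noteq> {}"
  shows "cauchy_perimeter S \<le> cauchy_perimeter T"
  unfolding cauchy_perimeter_def
  using assms bounded_subset[OF assms(1,2)]
  by (intro integral_le integrable_support_dirv support_mono) auto

text \<open>Widths are what projections of a curve control. The reflected term is the perimeter
  integral shifted by half a period.\<close>

lemma cauchy_perimeter_width:
  assumes "bounded S" "S \<noteq> {}"
  shows "2 * cauchy_perimeter S
    = integral {0..2 * pi} (\<lambda>\<theta>. support S (dirv \<theta>) + support S (- dirv \<theta>))"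
proof -
  have "integral {0..2 * pi} (\<lambda>\<theta>. support S (- dirv \<theta>)) = cauchy_perimeter S"
    unfolding cauchy_perimeter_period[OF assms, of pi]
    using integral_shift[of 0 pi "2 * pi", OF continuous_on_support_dirv[OF assms]]
    by (simp add: o_def dirv_plus_pi add.commute)
  moreover have "(\<lambda>\<theta>. support S (- dirv \<theta>)) integrable_on {0..2 * pi}"
    using continuous_on_support_minus_dirv[OF assms] by (rule integrable_continuous_real)
  ultimately show ?thesis
    using assms by (simp add: Henstock_Kurzweil_Integration.integral_add integrable_support_dirv cauchy_perimeter_def)
qed

text \<open>The support function is at most \<open>x \<bullet> dirv \<theta> + r\<close>, and the
  linear part integrates to zero over a full period.\<close>

lemma cauchy_perimeter_le_radius:
  assumes "x \<in> S" and "\<And>y. y \<in> S \<Longrightarrow> norm (y - x) \<le> r"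
  shows "cauchy_perimeter S \<le> 2 * pi * r"
proof -
  have "S \<subseteq> cball x r" using assms(2) by (auto simp: dist_norm norm_minus_commute)
  then have bdd: "bounded S" by (rule bounded_subset[OF bounded_cball])
  have ne: "S \<noteq> {}" using assms(1) by auto
  have xint: "(\<lambda>\<theta>. x \<bullet> dirv \<theta>) integrable_on {0..2 * pi}"
    using has_integral_inner_dirv[of 0 "2 * pi" x] by auto
  have "cauchy_perimeter S \<le> integral {0..2 * pi} (\<lambda>\<theta>. x \<bullet> dirv \<theta> + r)"
    unfolding cauchy_perimeter_def
  proof (intro integral_le integrable_support_dirv bdd ne integrable_add xint integrable_const_ivl support_least)
    fix y \<theta> assume "y \<in> S"
    have "(y - x) \<bullet> dirv \<theta> \<le> norm (y - x) * norm (dirv \<theta>)" by (rule norm_cauchy_schwarz)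
    also have "\<dots> \<le> r" using assms(2)[OF \<open>y \<in> S\<close>] by simp
    finally show "y \<bullet> dirv \<theta> \<le> x \<bullet> dirv \<theta> + r" by (simp add: inner_diff_left)
  qed
  also have "\<dots> = 2 * pi * r"
    using Henstock_Kurzweil_Integration.integral_add[OF xint integrable_const_ivl[of r]]
    by (simp add: integral_inner_dirv_period)
  finally show ?thesis .
qed

text \<open>For normal directions \<open>\<theta>\<close> of \<open>S\<close> at \<open>x\<close>, passing from \<open>S\<close> to \<open>T\<close> raises the support
  function at least by \<open>(w - x) \<bullet> dirv \<theta>\<close>.\<close>
lemma cauchy_perimeter_growth:
  assumes bdd: "bounded T" and ST: "S \<subseteq> T" and x: "x \<in> S" and w: "w \<in> T"
    and pq: "p \<le> q" "q \<le> p + 2 * pi"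
    and normal: "\<And>\<theta> y. \<theta> \<in> {p..q} \<Longrightarrow> y \<in> S \<Longrightarrow> (y - x) \<bullet> dirv \<theta> \<le> 0"
  shows "(w - x) $ 1 * (sin q - sin p) + (w - x) $ 2 * (cos p - cos q)
    \<le> cauchy_perimeter T - cauchy_perimeter S"
proof -
  note S = bounded_subset[OF bdd ST]
  have ne: "S \<noteq> {}" "T \<noteq> {}" using x w by auto
  let ?d = "\<lambda>\<theta>. support T (dirv \<theta>) - support S (dirv \<theta>)"
  have int: "?d integrable_on {u..v}" for u v
    by (intro integrable_diff integrable_support_dirv bdd S ne)
  have "(w - x) $ 1 * (sin q - sin p) + (w - x) $ 2 * (cos p - cos q) \<le> integral {p..q} ?d"
  proof (rule has_integral_le[OF has_integral_inner_dirv[OF pq(1)] integrable_integral[OF int]])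
    fix \<theta> assume \<theta>: "\<theta> \<in> {p..q}"
    have "support S (dirv \<theta>) \<le> x \<bullet> dirv \<theta>"
      using normal[OF \<theta>] ne by (intro support_least) (auto simp: inner_diff_left)
    moreover have "w \<bullet> dirv \<theta> \<le> support T (dirv \<theta>)" by (rule support_upper[OF bdd w])
    ultimately show "(w - x) \<bullet> dirv \<theta> \<le> ?d \<theta>" by (simp add: inner_diff_left)
  qed
  \<comment> \<open>Off the arc the difference of the support functions is still nonnegative, by
    monotonicity.\<close>
  also have "\<dots> \<le> integral {p..p + 2 * pi} ?d"
    using pq support_mono[OF bdd ST ne(1)] by (intro integral_subset_le int) auto
  also have "\<dots> = cauchy_perimeter T - cauchy_perimeter S"
    unfolding cauchy_perimeter_period[OF bdd ne(2), of p] cauchy_perimeter_period[OF S ne(1), of p]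
    by (intro Henstock_Kurzweil_Integration.integral_diff integrable_support_dirv bdd S ne)
  finally show ?thesis .
qed

section \<open>Perimeters of convex sets\<close>

lemma sum_le_curve_length:
  assumes "mono_on {..n} t" "t 0 = a" "t n = b"
  shows "ennreal (\<Sum>i<n. dist (g (t i)) (g (t (Suc i)))) \<le> curve_length g a b"
  unfolding curve_length_def using assms
  by (intro SUP_upper2[of "(n, t)"]) auto

lemma abs_diff_le_sum:
  fixes f :: "nat \<Rightarrow> real"
  assumes "j \<le> k"
  shows "\<bar>f k - f j\<bar> \<le> (\<Sum>i=j..<k. \<bar>f (Suc i) - f i\<bar>)"
  using assms
proof (induction k rule: dec_induct)
  case (step k)
  then show ?case by simp
qed simp

text \<open>A closed walk on the line covers the way between \<open>f j\<close> and
  \<open>f k\<close> twice, once wrapping around through \<open>f n = f 0\<close>.\<close>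

lemma closed_variation_ge_twice_range:
  fixes f :: "nat \<Rightarrow> real"
  assumes "f n = f 0" "j \<le> n" "k \<le> n"
  shows "2 * (f j - f k) \<le> (\<Sum>i<n. \<bar>f (Suc i) - f i\<bar>)"
proof -
  have *: "2 * \<bar>f j - f k\<bar> \<le> (\<Sum>i<n. \<bar>f (Suc i) - f i\<bar>)" if "j \<le> k" "k \<le> n" for j k
  proof -
    have "(\<Sum>i<n. \<bar>f (Suc i) - f i\<bar>) = (\<Sum>i=0..<j. \<bar>f (Suc i) - f i\<bar>)
        + (\<Sum>i=j..<k. \<bar>f (Suc i) - f i\<bar>) + (\<Sum>i=k..<n. \<bar>f (Suc i) - f i\<bar>)"
      using that by (simp add: sum.atLeastLessThan_concat lessThan_atLeast0)
    moreover have "\<bar>f k - f j\<bar> \<le> \<bar>f n - f k\<bar> + \<bar>f j - f 0\<bar>" using assms(1) by linarith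
    ultimately show ?thesis
      using abs_diff_le_sum[OF le0, of f j] abs_diff_le_sum[OF that(1), of f] abs_diff_le_sum[OF that(2), of f]
      by (simp add: abs_minus_commute)
  qed
  have "2 * \<bar>f j - f k\<bar> \<le> (\<Sum>i<n. \<bar>f (Suc i) - f i\<bar>)"
    using *[of j k] *[of k j] assms by (cases "j \<le> k") (auto simp: abs_minus_commute)
  moreover have "2 * (f j - f k) \<le> 2 * \<bar>f j - f k\<bar>" by (rule mult_left_mono) auto
  ultimately show ?thesis by (rule order_trans[rotated])
qed

text \<open>Crofton's argument: the length of a curve is a quarter of the integral over all directions of
  the variation of its projections, and the projection of a closed curve covers its range twice.\<close>
lemma cauchy_perimeter_le_curve_length:
  fixes \<gamma> :: "real \<Rightarrow> real ^ 2"
  assumes bdd: "bounded S" and ne: "S \<noteq> {}"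
    and path: "path \<gamma>" and closed: "pathfinish \<gamma> = pathstart \<gamma>"
    and ext: "\<And>\<theta>. \<exists>z\<in>path_image \<gamma>. support S (dirv \<theta>) \<le> z \<bullet> dirv \<theta>"
  shows "ennreal (cauchy_perimeter S) \<le> curve_length \<gamma> 0 1"
proof (rule ennreal_le_epsilon)
  fix e :: real assume "0 < e"
  \<comment> \<open>The error is \<open>2 * d\<close> in each width,
    \<open>4 * pi * d = 2 * e\<close> after integration, and then halved because the integrated
    width is twice the perimeter.\<close>
  define d where "d = e / (2 * pi)"
  have "0 < d" using \<open>0 < e\<close> by (simp add: d_def)
  have "uniformly_continuous_on {0..1} \<gamma>"
    using path by (intro compact_uniformly_continuous) (auto simp: path_def)
  then obtain \<delta> where \<delta>: "0 < \<delta>"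
    "\<And>x y. x \<in> {0..1} \<Longrightarrow> y \<in> {0..1} \<Longrightarrow> dist y x < \<delta> \<Longrightarrow> dist (\<gamma> y) (\<gamma> x) < d"
    using \<open>0 < d\<close> unfolding uniformly_continuous_on_def by metis
  obtain m :: nat where m: "1 / real (Suc m) < \<delta>"
    using \<delta>(1) nat_approx_posE by metis
  define n where "n = Suc m"
  define v where "v i = \<gamma> (real i / real n)" for i
  have vn: "v n = v 0" using closed by (simp add: v_def n_def pathfinish_def pathstart_def)
  have near: "\<exists>j\<le>n. norm (z - v j) \<le> d" if z: "z \<in> path_image \<gamma>" for z
  proof -
    obtain s where "z = \<gamma> s" "s \<in> {0..1}" using z unfolding path_image_def by blast
    then have s: "z = \<gamma> s" "0 \<le> s" "s \<le> 1" by auto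
    define j where "j = nat \<lfloor>s * n\<rfloor>"
    have j: "real j \<le> s * n" "s * n < real j + 1"
      using s by (simp_all add: j_def)
    have "real j \<le> 1 * real n" using j(1) s(3) mult_right_mono[of s 1 "real n"] by linarith
    then have "j \<le> n" by simp
    have "\<bar>s - real j / n\<bar> < \<delta>"
    proof -
      have "\<bar>s - real j / n\<bar> = \<bar>s * n - real j\<bar> / n" by (simp add: n_def field_simps abs_div)
      also have "\<dots> \<le> 1 / n" using j by (intro divide_right_mono) auto
      finally show ?thesis using m by (simp add: n_def)
    qed
    moreover have "real j / n \<in> {0..1}" using \<open>j \<le> n\<close> by (simp add: n_def)
    ultimately have "norm (z - v j) < d"
      using \<delta>(2)[of "real j / n" s] s by (simp add: v_def dist_norm)
    with \<open>j \<le> n\<close> show ?thesis by (auto intro: less_imp_le)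
  qed
  have supp: "\<exists>j\<le>n. support S (dirv \<theta>) \<le> v j \<bullet> dirv \<theta> + d" for \<theta>
  proof -
    obtain z where z: "z \<in> path_image \<gamma>" "support S (dirv \<theta>) \<le> z \<bullet> dirv \<theta>" using ext by blast
    obtain j where j: "j \<le> n" "norm (z - v j) \<le> d" using near[OF z(1)] by blast
    have "(z - v j) \<bullet> dirv \<theta> \<le> norm (z - v j) * norm (dirv \<theta>)" by (rule norm_cauchy_schwarz)
    then show ?thesis using z j by (intro exI[of _ j]) (simp add: inner_diff_left)
  qed
  define var where "var \<theta> = (\<Sum>i<n. \<bar>(v (Suc i) - v i) \<bullet> dirv \<theta>\<bar>)" for \<theta>
  have width: "support S (dirv \<theta>) + support S (- dirv \<theta>) \<le> var \<theta> / 2 + 2 * d" for \<theta>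
  proof -
    obtain j where j: "j \<le> n" "support S (dirv \<theta>) \<le> v j \<bullet> dirv \<theta> + d" using supp by blast
    obtain k where k: "k \<le> n" "support S (- dirv \<theta>) \<le> - (v k \<bullet> dirv \<theta>) + d"
      using supp[of "\<theta> + pi"] by (auto simp: dirv_plus_pi)
    have "2 * (v j \<bullet> dirv \<theta> - v k \<bullet> dirv \<theta>) \<le> var \<theta>"
      using closed_variation_ge_twice_range[of "\<lambda>i. v i \<bullet> dirv \<theta>" n j k] vn j k
      by (simp add: inner_diff_left var_def)
    moreover have "support S (dirv \<theta>) + support S (- dirv \<theta>)
        \<le> (v j \<bullet> dirv \<theta> + d) + (- (v k \<bullet> dirv \<theta>) + d)"
      using j(2) k(2) by (rule add_mono)
    ultimately show ?thesis by (simp add: field_simps)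
  qed
  have var_int: "(\<lambda>\<theta>. var \<theta> / 2) integrable_on {0..2 * pi}"
    unfolding var_def by (intro integrable_on_divide integrable_sum integrable_abs_inner_dirv) simp
  have "2 * cauchy_perimeter S \<le> integral {0..2 * pi} (\<lambda>\<theta>. var \<theta> / 2 + 2 * d)"
    unfolding cauchy_perimeter_width[OF bdd ne] using width
    by (intro integral_le integrable_width[OF bdd ne] integrable_add var_int integrable_const_ivl) auto
  also have "\<dots> = integral {0..2 * pi} var / 2 + 4 * pi * d"
    using Henstock_Kurzweil_Integration.integral_add[OF var_int integrable_const_ivl[of "2 * d"]] by simp
  also have "integral {0..2 * pi} var = (\<Sum>i<n. 4 * norm (v (Suc i) - v i))"
    unfolding var_def by (simp add: integral_sum integrable_abs_inner_dirv integral_abs_inner_dirv)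
  finally have "cauchy_perimeter S \<le> (\<Sum>i<n. norm (v (Suc i) - v i)) + e"
    using \<open>0 < e\<close> by (simp add: d_def flip: sum_distrib_left)
  also have "(\<Sum>i<n. norm (v (Suc i) - v i)) = (\<Sum>i<n. dist (v i) (v (Suc i)))"
    by (simp add: dist_norm norm_minus_commute)
  finally have "ennreal (cauchy_perimeter S) \<le> ennreal (\<Sum>i<n. dist (v i) (v (Suc i))) + ennreal e"
    using \<open>0 < e\<close> by (subst ennreal_plus[symmetric]) (auto intro!: sum_nonneg ennreal_leI)
  also have "ennreal (\<Sum>i<n. dist (v i) (v (Suc i))) \<le> curve_length \<gamma> 0 1"
    using sum_le_curve_length[of n "\<lambda>i. real i / real n" 0 1 \<gamma>]
    by (auto simp: v_def n_def mono_on_def divide_right_mono)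
  finally show "ennreal (cauchy_perimeter S) \<le> curve_length \<gamma> 0 1 + ennreal e"
    by (simp add: add_right_mono)
qed

lemma support_attained:
  assumes "compact S" "S \<noteq> {}"
  obtains y where "y \<in> S" "support S v = y \<bullet> v"
proof -
  have "continuous_on S (\<lambda>x. x \<bullet> v)" by (intro continuous_intros)
  then obtain y where y: "y \<in> S" "\<And>x. x \<in> S \<Longrightarrow> x \<bullet> v \<le> y \<bullet> v"
    using continuous_attains_sup[OF assms] by metis
  then have "support S v = y \<bullet> v"
    using assms by (intro antisym support_least support_upper compact_imp_bounded)
  with y show thesis using that by blast
qed

lemma maximizer_in_frontier:
  fixes y :: "'a::euclidean_space"
  assumes "y \<in> S" "v \<noteq> 0" and max: "\<And>x. x \<in> S \<Longrightarrow> x \<bullet> v \<le> y \<bullet> v"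
  shows "y \<in> frontier S"
proof (rule ccontr)
  assume "y \<notin> frontier S"
  then have "y \<in> interior S"
    using assms(1) closure_subset by (auto simp: frontier_def)
  then obtain e where e: "0 < e" "cball y e \<subseteq> S" using mem_interior_cball by blast
  have "y + (e / norm v) *\<^sub>R v \<in> S"
    using e assms(2) by (intro subsetD[OF e(2)]) (simp add: dist_norm)
  from max[OF this] have "e / norm v * (v \<bullet> v) \<le> 0" by (simp add: inner_add_left)
  moreover have "0 < e / norm v * (v \<bullet> v)" using e assms(2) by simp
  ultimately show False by linarith
qed

text \<open>Ensures that the choice in \<open>perimeter\<close> returns a frontier curve. The circle
  is carried over by a homeomorphism between the frontiers of the disk and of
  \<open>K\<close>.\<close>

lemma closed_curve_frontier_convex:
  fixes K :: "(real ^ 2) set"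
  assumes "convex K" "bounded K" "interior K \<noteq> {}"
  obtains \<gamma> where "simple_path \<gamma>" "pathfinish \<gamma> = pathstart \<gamma>" "path_image \<gamma> = frontier K"
proof -
  have "rel_frontier (cball (0 :: real ^ 2) 1) homeomorphic rel_frontier K"
    using assms by (intro homeomorphic_rel_frontiers_convex_bounded_sets)
      (auto simp: aff_dim_nonempty_interior)
  then have "sphere (0 :: real ^ 2) 1 homeomorphic frontier K"
    using assms by (simp add: rel_frontier_nonempty_interior)
  then obtain f h where fh: "homeomorphism (sphere (0 :: real ^ 2) 1) (frontier K) f h"
    unfolding homeomorphic_def by blast
  define c where "c = (\<lambda>t. dirv (2 * pi * t))"
  have im: "path_image c = sphere 0 1"
  proof (intro equalityI subsetI)
    fix z :: "real ^ 2" assume "z \<in> sphere 0 1"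
    then obtain \<theta> where "0 \<le> \<theta>" "\<theta> < 2 * pi" "z = dirv \<theta>"
      using unit_vector_dirv[of z] by auto
    then show "z \<in> path_image c"
      unfolding path_image_def c_def by (intro image_eqI[of _ _ "\<theta> / (2 * pi)"]) auto
  qed (auto simp: path_image_def c_def)
  have "path c"
    unfolding path_def c_def
    by (intro continuous_on_compose2[OF continuous_on_dirv[of UNIV]] continuous_intros) auto
  moreover have "loop_free c"
    unfolding loop_free_def
  proof (intro ballI impI)
    fix x y :: real assume xy: "x \<in> {0..1}" "y \<in> {0..1}" "c x = c y"
    from xy(3) have "c x $ 1 = c y $ 1" "c x $ 2 = c y $ 2" by simp_all
    then obtain k :: int where "2 * pi * x = 2 * pi * y + 2 * pi * k"
      using sin_cos_eq_iff[of "2 * pi * x" "2 * pi * y"] by (auto simp: c_def)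
    then have "2 * pi * x = 2 * pi * (y + k)" by (simp add: algebra_simps)
    then have k: "x = y + k" by simp
    then have "-1 \<le> real_of_int k" "real_of_int k \<le> 1" using xy by auto
    then have "k = -1 \<or> k = 0 \<or> k = 1" by linarith
    with k xy show "x = y \<or> x = 0 \<and> y = 1 \<or> x = 1 \<and> y = 0" by auto
  qed
  ultimately have "simple_path c" by (simp add: simple_path_def)
  moreover have "inj_on f (sphere 0 1)"
    using fh by (metis homeomorphism_def inj_on_inverseI)
  ultimately have "simple_path (f \<circ> c)"
    using fh by (intro simple_path_continuous_image) (auto simp: im homeomorphism_def)
  moreover have "pathfinish (f \<circ> c) = pathstart (f \<circ> c)"
    using dirv_periodic[of 0] by (simp add: pathfinish_def pathstart_def c_def)
  moreover have "path_image (f \<circ> c) = frontier K"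
    using fh by (simp add: path_image_compose im homeomorphism_def)
  ultimately show thesis by (rule that)
qed

text \<open>If \<open>K\<close> lies on a line, each width is at most the diameter times the
  absolute cosine of the angle with that line. Otherwise extreme points lie on the frontier, so
  Crofton's bound applies to whichever curve the choice in \<open>perimeter\<close> returns.\<close>

lemma cauchy_perimeter_le_perimeter:
  assumes "convex K" "compact K" "K \<noteq> {}"
  shows "ennreal (cauchy_perimeter K) \<le> perimeter K"
proof (cases "interior K = {}")
  case True
  note bdd = compact_imp_bounded[OF assms(2)]
  obtain p r where p: "p \<noteq> 0" "K \<subseteq> {x. p \<bullet> x = r}"
    using empty_interior_subset_hyperplane[OF assms(1) True] by blast
  obtain \<alpha> where \<alpha>: "(1 / norm p) *\<^sub>R p = dirv \<alpha>"
    using unit_vector_dirv[of "(1 / norm p) *\<^sub>R p"] p(1) by auto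
  \<comment> \<open>\<open>dirv \<alpha>\<close> is normal to the line that contains
    \<open>K\<close>, so \<open>u\<close> is a unit vector along it.\<close>
  define u where "u = dirv (\<alpha> + pi / 2)"
  have width: "support K (dirv \<theta>) + support K (- dirv \<theta>) \<le> diameter K * \<bar>u \<bullet> dirv \<theta>\<bar>" for \<theta>
  proof -
    obtain y where y: "y \<in> K" "support K (dirv \<theta>) = y \<bullet> dirv \<theta>"
      using support_attained[OF assms(2,3)] by blast
    obtain z where z: "z \<in> K" "support K (- dirv \<theta>) = z \<bullet> (- dirv \<theta>)"
      using support_attained[OF assms(2,3)] by blast
    obtain \<beta> where \<beta>: "y - z = norm (y - z) *\<^sub>R dirv \<beta>"
    proof (cases "y = z")
      case False
      then obtain \<beta> where "(1 / norm (y - z)) *\<^sub>R (y - z) = dirv \<beta>"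
        using unit_vector_dirv[of "(1 / norm (y - z)) *\<^sub>R (y - z)"] by auto
      then have "norm (y - z) *\<^sub>R (1 / norm (y - z)) *\<^sub>R (y - z) = norm (y - z) *\<^sub>R dirv \<beta>" by simp
      then show ?thesis using False that by simp
    qed (use that in auto)
    have "dirv \<alpha> \<bullet> (y - z) = 0"
      using p(2) y(1) z(1) by (auto simp flip: \<alpha> simp: inner_diff_right)
    then have "norm (y - z) * cos (\<alpha> - \<beta>) = 0"
      by (subst (asm) \<beta>) (simp add: dirv_inner_dirv)
    have "(y - z) \<bullet> dirv \<theta> = norm (y - z) * cos (\<beta> - \<theta>)"
      by (subst \<beta>) (simp add: dirv_inner_dirv)
    also have "cos (\<beta> - \<theta>) = cos (\<alpha> - \<theta>) * cos (\<alpha> - \<beta>) + sin (\<alpha> - \<theta>) * sin (\<alpha> - \<beta>)"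
      using cos_diff[of "\<alpha> - \<theta>" "\<alpha> - \<beta>"] by simp
    also have "norm (y - z) * \<dots> = norm (y - z) * (sin (\<alpha> - \<theta>) * sin (\<alpha> - \<beta>))"
      using \<open>norm (y - z) * cos (\<alpha> - \<beta>) = 0\<close> by auto
    also have "\<dots> \<le> norm (y - z) * \<bar>sin (\<alpha> - \<theta>)\<bar>"
    proof (intro mult_left_mono)
      have "sin (\<alpha> - \<theta>) * sin (\<alpha> - \<beta>) \<le> \<bar>sin (\<alpha> - \<theta>)\<bar> * \<bar>sin (\<alpha> - \<beta>)\<bar>"
        by (simp flip: abs_mult)
      also have "\<dots> \<le> \<bar>sin (\<alpha> - \<theta>)\<bar> * 1" by (intro mult_left_mono) auto
      finally show "sin (\<alpha> - \<theta>) * sin (\<alpha> - \<beta>) \<le> \<bar>sin (\<alpha> - \<theta>)\<bar>" by simp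
    qed simp
    also have "\<dots> \<le> diameter K * \<bar>sin (\<alpha> - \<theta>)\<bar>"
      using diameter_bounded_bound[OF bdd y(1) z(1)] by (intro mult_right_mono) (auto simp: dist_norm)
    also have "\<bar>sin (\<alpha> - \<theta>)\<bar> = \<bar>u \<bullet> dirv \<theta>\<bar>"
      using cos_add[of "\<alpha> - \<theta>" "pi / 2"] by (simp add: u_def dirv_inner_dirv diff_add_eq)
    finally show ?thesis using y z by (simp add: inner_diff_left)
  qed
  have "2 * cauchy_perimeter K \<le> integral {0..2 * pi} (\<lambda>\<theta>. diameter K * \<bar>u \<bullet> dirv \<theta>\<bar>)"
    unfolding cauchy_perimeter_width[OF bdd assms(3)] using width
    by (intro integral_le integrable_width[OF bdd assms(3)] integrable_on_mult_right integrable_abs_inner_dirv)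
  also have "\<dots> = 4 * diameter K"
    by (simp add: integral_abs_inner_dirv u_def)
  finally show ?thesis using True by (auto simp: perimeter_def intro!: ennreal_leI)
next
  case False
  define \<gamma> where "\<gamma> = (SOME \<gamma>. simple_path \<gamma> \<and> pathfinish \<gamma> = pathstart \<gamma> \<and> path_image \<gamma> = frontier K)"
  have \<gamma>: "simple_path \<gamma>" "pathfinish \<gamma> = pathstart \<gamma>" "path_image \<gamma> = frontier K"
  proof -
    have "\<exists>\<gamma>. simple_path \<gamma> \<and> pathfinish \<gamma> = pathstart \<gamma> \<and> path_image \<gamma> = frontier K"
      using closed_curve_frontier_convex[OF assms(1) compact_imp_bounded[OF assms(2)] False] by metis
    from someI_ex[OF this] show "simple_path \<gamma>" "pathfinish \<gamma> = pathstart \<gamma>" "path_image \<gamma> = frontier K"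
      by (simp_all add: \<gamma>_def)
  qed
  have "ennreal (cauchy_perimeter K) \<le> curve_length \<gamma> 0 1"
  proof (rule cauchy_perimeter_le_curve_length)
    fix \<theta>
    obtain y where y: "y \<in> K" "support K (dirv \<theta>) = y \<bullet> dirv \<theta>"
      using support_attained[OF assms(2,3)] by blast
    have "dirv \<theta> \<noteq> 0" using norm_dirv[of \<theta>] by (metis norm_zero zero_neq_one)
    then have "y \<in> frontier K"
      using y support_upper[OF compact_imp_bounded[OF assms(2)], of _ "dirv \<theta>"]
      by (intro maximizer_in_frontier[of y K "dirv \<theta>"]) auto
    then show "\<exists>z\<in>path_image \<gamma>. support K (dirv \<theta>) \<le> z \<bullet> dirv \<theta>"
      using y \<gamma> by auto
  qed (use \<gamma> assms in \<open>auto simp: compact_imp_bounded simple_path_imp_path\<close>)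
  then show ?thesis using False by (simp add: perimeter_def \<gamma>_def)
qed

section \<open>Growth along curves\<close>

text \<open>\<open>G\<close> will be the perimeter of the past, whose continuity is not known. At
  the supremum of the good points \<open>F\<close> passes to the limit while \<open>G\<close> is at
  least its earlier values, so the supremum is good as well; \<open>right\<close> then carries the
  inequality further.\<close>

lemma continuous_plus_mono_growth:
  fixes F G :: "real \<Rightarrow> real"
  assumes ab: "a \<le> b" and F: "continuous_on {a..b} F" and G: "mono_on {a..b} G"
    and right: "\<And>t. a \<le> t \<Longrightarrow> t < b \<Longrightarrow> eventually (\<lambda>s. F t + G t \<le> F s + G s) (at_right t)"
  shows "F a + G a \<le> F b + G b"
proof -
  define S where "S = {s \<in> {a..b}. F a + G a \<le> F s + G s}"
  define c where "c = Sup S"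
  have S: "a \<in> S" "bdd_above S" using ab by (auto simp: S_def intro: bdd_aboveI[of _ b])
  have "a \<le> c" unfolding c_def by (rule cSup_upper[OF S])
  moreover have "c \<le> b" unfolding c_def
  proof (rule cSup_least)
    show "S \<noteq> {}" using S(1) by blast
  qed (simp add: S_def)
  ultimately have c: "a \<le> c" "c \<le> b" by auto
  have "c \<in> closure S" unfolding c_def using S by (intro closure_contains_Sup) auto
  then obtain x where x: "\<And>n. x n \<in> S" "x \<longlonglongrightarrow> c" by (auto simp: closure_sequential)
  have "F a + G a \<le> F (x n) + G c" for n
  proof -
    have "x n \<le> c" using x(1)[of n] S unfolding c_def by (intro cSup_upper)
    then have "G (x n) \<le> G c" using x(1)[of n] c by (intro mono_onD[OF G]) (auto simp: S_def)
    then show ?thesis using x(1)[of n] by (simp add: S_def)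
  qed
  moreover have "(\<lambda>n. F (x n)) \<longlonglongrightarrow> F c"
    using x c by (intro continuous_on_tendsto_compose[OF F]) (auto simp: S_def)
  then have "(\<lambda>n. F (x n) + G c) \<longlonglongrightarrow> F c + G c" by (intro tendsto_intros)
  ultimately have cS: "F a + G a \<le> F c + G c"
    by (intro LIMSEQ_le_const) auto
  have "c = b"
  proof (rule ccontr)
    assume "c \<noteq> b"
    with c have "c < b" by simp
    from right[OF c(1) this] obtain d where d: "c < d" "\<And>s. c < s \<Longrightarrow> s < d \<Longrightarrow> F c + G c \<le> F s + G s"
      using eventually_at_right[OF \<open>c < b\<close>] by auto
    obtain s where s: "c < s" "s < min d b" using dense[of c "min d b"] d \<open>c < b\<close> by auto
    then have "s \<in> S" using d(2)[of s] cS c by (auto simp: S_def)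
    then have "s \<le> c" unfolding c_def using S by (intro cSup_upper)
    with s show False by simp
  qed
  with cS show ?thesis by simp
qed

lemma has_derivative_sequence_direction:
  fixes \<Phi> :: "'a::real_normed_vector \<Rightarrow> real"
  assumes der: "(\<Phi> has_derivative L) (at x)" and z: "z \<longlonglongrightarrow> x" "\<And>n. z n \<noteq> x"
    and dir: "(\<lambda>n. (1 / norm (z n - x)) *\<^sub>R (z n - x)) \<longlonglongrightarrow> l"
  shows "(\<lambda>n. (\<Phi> (z n) - \<Phi> x) / norm (z n - x)) \<longlonglongrightarrow> L l"
proof -
  interpret L: bounded_linear L using der by (rule has_derivative_bounded_linear)
  have "((\<lambda>y. (\<Phi> y - \<Phi> x - L (y - x)) / norm (y - x)) \<longlongrightarrow> 0) (at x)"
    using der by (simp add: has_derivative_at_within divide_inverse mult.commute)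
  moreover have "filterlim z (at x) sequentially"
    using z by (simp add: filterlim_at)
  ultimately have "(\<lambda>n. (\<Phi> (z n) - \<Phi> x - L (z n - x)) / norm (z n - x)) \<longlonglongrightarrow> 0"
    by (rule filterlim_compose)
  moreover have "(\<lambda>n. L ((1 / norm (z n - x)) *\<^sub>R (z n - x))) \<longlonglongrightarrow> L l"
    using dir by (rule L.tendsto)
  ultimately have "(\<lambda>n. (\<Phi> (z n) - \<Phi> x - L (z n - x)) / norm (z n - x)
      + L ((1 / norm (z n - x)) *\<^sub>R (z n - x))) \<longlonglongrightarrow> 0 + L l"
    by (rule tendsto_add)
  moreover have "(\<Phi> (z n) - \<Phi> x - L (z n - x)) / norm (z n - x)
      + L ((1 / norm (z n - x)) *\<^sub>R (z n - x)) = (\<Phi> (z n) - \<Phi> x) / norm (z n - x)" for n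
    unfolding L.scaleR by (simp add: diff_divide_distrib)
  ultimately show ?thesis by simp
qed

text \<open>Continuous injective curves need not be differentiable, but limit directions of their secants
  to the right of \<open>t\<close> lie in the forward tangent cone; so testing on that cone suffices.\<close>
lemma eventually_growth_from_tangents:
  fixes g :: "real \<Rightarrow> 'a::euclidean_space" and \<Psi> :: "real \<Rightarrow> real"
  assumes t: "a \<le> t" "t < b" and cont: "continuous_on {a..b} g" and inj: "inj_on g {a..b}"
    and test: "\<And>l. norm l = 1 \<Longrightarrow> l \<in> tangent_cone (g ` {t..b}) (g t) \<Longrightarrow>
      \<exists>\<Phi> L. (\<Phi> has_derivative L) (at (g t)) \<and> m < L l \<and>
        (\<forall>s. t < s \<longrightarrow> s \<le> b \<longrightarrow> \<Phi> (g s) - \<Phi> (g t) \<le> \<Psi> s - \<Psi> t)"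
  shows "eventually (\<lambda>s. m * norm (g s - g t) \<le> \<Psi> s - \<Psi> t) (at_right t)"
proof (rule ccontr)
  assume "\<not> ?thesis"
  then have ex: "\<exists>s. t < s \<and> s < d \<and> \<Psi> s - \<Psi> t < m * norm (g s - g t)" if "t < d" for d
    using that unfolding eventually_at_right[OF t(2)] by (force simp: not_le)
  have "\<forall>n. \<exists>s. t < s \<and> s < min b (t + inverse (real (Suc n))) \<and> \<Psi> s - \<Psi> t < m * norm (g s - g t)"
    by (intro allI ex) (use t in simp)
  from choice[OF this] obtain s where
    "\<forall>n. t < s n \<and> s n < min b (t + inverse (real (Suc n))) \<and> \<Psi> (s n) - \<Psi> t < m * norm (g (s n) - g t)"
    by blast
  then have s: "\<And>n. t < s n" "\<And>n. s n < min b (t + inverse (real (Suc n)))"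
    "\<And>n. \<Psi> (s n) - \<Psi> t < m * norm (g (s n) - g t)" by blast+
  have "s \<longlonglongrightarrow> t"
  proof (rule tendsto_sandwich[of "\<lambda>n. t" _ _ "\<lambda>n. t + inverse (real (Suc n))"])
    show "\<forall>\<^sub>F n in sequentially. t \<le> s n" "\<forall>\<^sub>F n in sequentially. s n \<le> t + inverse (real (Suc n))"
      using s(1) s(2)[unfolded min_less_iff_conj] by (intro always_eventually allI less_imp_le; blast)+
    show "(\<lambda>n. t + inverse (real (Suc n))) \<longlonglongrightarrow> t"
      using tendsto_add[OF tendsto_const LIMSEQ_inverse_real_of_nat] by simp
  qed simp
  define z where "z n = g (s n)" for n
  have z: "z n \<noteq> g t" for n
    using inj_onD[OF inj, of "s n" t] s(1)[of n] s(2)[of n] t by (auto simp: z_def)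
  define d where "d n = (1 / norm (z n - g t)) *\<^sub>R (z n - g t)" for n
  have "d n \<in> sphere 0 1" for n using z[of n] by (simp add: d_def)
  \<comment> \<open>Compactness of the unit sphere yields a limit direction \<open>l\<close> of
    secants at violating times; \<open>\<Phi>\<close> is chosen only afterwards, so it may depend on
    \<open>l\<close>.\<close>
  then have "\<exists>l\<in>sphere 0 1. \<exists>r. strict_mono r \<and> (d \<circ> r) \<longlonglongrightarrow> l"
    using compact_sphere[of "0 :: 'a" 1] unfolding compact_def by blast
  then obtain l r where l: "l \<in> sphere 0 1" and r: "strict_mono r" and dl: "(d \<circ> r) \<longlonglongrightarrow> l"
    by blast
  have "z \<longlonglongrightarrow> g t"
    unfolding z_def
  proof (rule continuous_on_tendsto_compose[OF cont \<open>s \<longlonglongrightarrow> t\<close>])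
    have "s n \<in> {a..b}" for n using s(1)[of n] s(2)[of n] t by auto
    then show "\<forall>\<^sub>F n in sequentially. s n \<in> {a..b}" by (intro always_eventually allI)
  qed (use t in auto)
  then have zr: "(z \<circ> r) \<longlonglongrightarrow> g t" using r by (rule LIMSEQ_subseq_LIMSEQ)
  have "l \<in> tangent_cone (g ` {t..b}) (g t)"
    unfolding tangent_cone_def
  proof (intro CollectI allI impI)
    fix e :: real assume "0 < e"
    have "\<forall>\<^sub>F n in sequentially. norm ((z \<circ> r) n - g t) < e" "\<forall>\<^sub>F n in sequentially. norm ((d \<circ> r) n - l) < e"
      using tendstoD[OF zr \<open>0 < e\<close>] tendstoD[OF dl \<open>0 < e\<close>] by (auto simp: dist_norm)
    then have "\<forall>\<^sub>F n in sequentially. norm (z (r n) - g t) < e \<and> norm (d (r n) - l) < e"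
      by eventually_elim auto
    then obtain n where n: "norm (z (r n) - g t) < e" "norm (d (r n) - l) < e"
      by (auto simp: eventually_sequentially)
    show "\<exists>x\<in>g ` {t..b}. \<exists>r>0. norm (x - g t) < e \<and> norm (r *\<^sub>R (x - g t) - l) < e"
    proof (intro bexI exI conjI)
      show "z (r n) \<in> g ` {t..b}" using s(1)[of "r n"] s(2)[of "r n"] by (auto simp: z_def)
      show "0 < 1 / norm (z (r n) - g t)" using z by simp
    qed (use n in \<open>auto simp: d_def\<close>)
  qed
  moreover have "norm l = 1" using l by simp
  ultimately obtain \<Phi> L where \<Phi>: "(\<Phi> has_derivative L) (at (g t))" "m < L l"
    "\<And>s. t < s \<Longrightarrow> s \<le> b \<Longrightarrow> \<Phi> (g s) - \<Phi> (g t) \<le> \<Psi> s - \<Psi> t" using test by blast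
  have "(\<lambda>n. (\<Phi> ((z \<circ> r) n) - \<Phi> (g t)) / norm ((z \<circ> r) n - g t)) \<longlonglongrightarrow> L l"
    using dl z by (intro has_derivative_sequence_direction[OF \<Phi>(1) zr]) (auto simp: d_def o_def)
  moreover have "(\<Phi> ((z \<circ> r) n) - \<Phi> (g t)) / norm ((z \<circ> r) n - g t) \<le> m" for n
    using \<Phi>(3)[of "s (r n)"] s(1)[of "r n"] s(2)[of "r n"] s(3)[of "r n"] z[of "r n"] by (simp add: z_def divide_le_eq)
  ultimately have "L l \<le> m" by (intro LIMSEQ_le_const2) auto
  with \<Phi>(2) show False by simp
qed

text \<open>With \<open>u = (1 / A) *\<^sub>R (y - x)\<close> and
  \<open>v = (1 / B) *\<^sub>R (z - x)\<close> the derivative reads \<open>((u \<bullet> v) * (h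
  \<bullet> u) - h \<bullet> v) / A + ((u \<bullet> v) * (h \<bullet> v) - h \<bullet> u) /
  B\<close>. In this form \<open>planar_unit_inner_lt\<close> makes each numerator positive.\<close>

lemma has_derivative_cos_angle:
  fixes x y z :: "'a::real_inner"
  assumes "x \<noteq> y" "x \<noteq> z"
  defines "A \<equiv> norm (y - x)" and "B \<equiv> norm (z - x)" and "I \<equiv> (y - x) \<bullet> (z - x)"
  shows "((\<lambda>x. ((y - x) \<bullet> (z - x)) / (norm (y - x) * norm (z - x))) has_derivative
    (\<lambda>h. (I / (A * B) * (h \<bullet> (y - x) / A) - h \<bullet> (z - x) / B) / A
       + (I / (A * B) * (h \<bullet> (z - x) / B) - h \<bullet> (y - x) / A) / B)) (at x)"
proof -
  have nz: "y - x \<noteq> 0" "z - x \<noteq> 0" using assms by auto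
  have dn: "((\<lambda>x. norm (w - x)) has_derivative (\<lambda>h. - (h \<bullet> (w - x)) / norm (w - x))) (at x)"
    if "w - x \<noteq> 0" for w
  proof -
    have "((\<lambda>x. w - x) has_derivative (\<lambda>h. - h)) (at x)"
      by (auto intro!: derivative_eq_intros)
    from has_derivative_compose[OF this has_derivative_norm[OF that]]
    show ?thesis by (simp add: sgn_div_norm divide_inverse mult.commute)
  qed
  have AB: "A \<noteq> 0" "B \<noteq> 0" using nz by (simp_all add: A_def B_def)
  have "((\<lambda>x. (y - x) \<bullet> (z - x)) has_derivative (\<lambda>h. - (h \<bullet> (z - x)) - h \<bullet> (y - x))) (at x)"
    by (auto intro!: derivative_eq_intros simp: inner_commute algebra_simps)
  note quotient = has_derivative_divide[OF this has_derivative_mult[OF dn[OF nz(1)] dn[OF nz(2)]]]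
  have "- I * (inverse (A * B) * (A * (- v / B) + - u / A * B) * inverse (A * B)) + (- v - u) / (A * B)
      = (I / (A * B) * (u / A) - v / B) / A + (I / (A * B) * (v / B) - u / A) / B" for u v
    using AB by (simp add: divide_simps) (simp add: algebra_simps power2_eq_square)
  then show ?thesis
    using AB unfolding A_def B_def I_def by (intro has_derivative_eq_rhs[OF quotient] ext) simp_all
qed

lemma has_derivative_ln_dist:
  fixes x y :: "'a::real_inner"
  assumes "x \<noteq> y"
  shows "((\<lambda>x. ln (norm (y - x))) has_derivative (\<lambda>h. - (h \<bullet> (y - x)) / (norm (y - x))\<^sup>2)) (at x)"
proof -
  have nz: "y - x \<noteq> 0" using assms by auto
  have "((\<lambda>x. y - x) has_derivative (\<lambda>h. - h)) (at x)"
    by (auto intro!: derivative_eq_intros)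
  from has_derivative_compose[OF this has_derivative_norm[OF nz]]
  have "((\<lambda>x. norm (y - x)) has_derivative (\<lambda>h. - (h \<bullet> (y - x)) / norm (y - x))) (at x)"
    by (simp add: sgn_div_norm divide_inverse mult.commute)
  moreover have "(ln has_derivative (\<lambda>h. h * inverse (norm (y - x)))) (at (norm (y - x)))"
    using DERIV_ln[of "norm (y - x)", unfolded zero_less_norm_iff, OF nz]
    by (simp only: has_field_derivative_def mult_commute_abs)
  ultimately have "((\<lambda>x. ln (norm (y - x))) has_derivative
      (\<lambda>h. - (h \<bullet> (y - x)) / norm (y - x) * inverse (norm (y - x)))) (at x)"
    by (rule has_derivative_compose)
  then show ?thesis by (simp add: power2_eq_square divide_inverse mult.assoc)
qed

section \<open>Sectors and normal arcs\<close>

text \<open>The conclusion says that the part of \<open>l\<close> orthogonal to \<open>v\<close>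
  points away from \<open>u\<close>, so moving along \<open>l\<close> turns the line of sight
  \<open>v\<close> towards \<open>u\<close>. If it failed, \<open>l\<close> and \<open>u\<close>
  would lie on one side of the line along \<open>v\<close> and enclose the angle
  \<open>\<bar>A - B\<bar>\<close>, with \<open>A\<close> and \<open>B\<close> their angles with
  \<open>v\<close>. For \<open>\<gamma> = arccos \<sigma>\<close> the hypotheses give
  \<open>\<gamma> \<le> A\<close> and \<open>pi - \<gamma> < B < 2 * \<gamma>\<close>, hence
  \<open>\<bar>A - B\<bar> < \<gamma>\<close>, against
  \<open>l \<bullet> u \<le> \<sigma>\<close>.\<close>

lemma planar_unit_inner_lt:
  fixes l u v :: "real ^ 2"
  assumes unit: "norm l = 1" "norm u = 1" "norm v = 1" and "0 < \<sigma>"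
    and lu: "l \<bullet> u \<le> \<sigma>" and lv: "l \<bullet> v \<le> \<sigma>" and F: "2 * \<sigma>\<^sup>2 - 1 < u \<bullet> v" "u \<bullet> v < - \<sigma>"
  shows "l \<bullet> u < (l \<bullet> v) * (u \<bullet> v)"
proof (rule ccontr)
  assume not: "\<not> ?thesis"
  obtain \<alpha> \<beta> \<delta> where dirs: "l = dirv \<alpha>" "u = dirv \<beta>" "v = dirv \<delta>"
    using unit unit_vector_dirv by metis
  have bounds: "\<bar>l \<bullet> v\<bar> \<le> 1" "\<bar>u \<bullet> v\<bar> \<le> 1"
    by (simp_all add: dirs dirv_inner_dirv)
  have "\<sigma> < 1" using F bounds by linarith
  define A B \<gamma> where "A = arccos (l \<bullet> v)" and "B = arccos (u \<bullet> v)" and "\<gamma> = arccos \<sigma>"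
  have A: "cos A = l \<bullet> v" "0 \<le> A" "A \<le> pi" "0 \<le> sin A"
    using bounds by (auto simp: A_def cos_arccos_abs arccos_lbound arccos_ubound intro!: sin_ge_zero)
  have B: "cos B = u \<bullet> v" "0 \<le> B" "B \<le> pi" "0 \<le> sin B"
    using bounds by (auto simp: B_def cos_arccos_abs arccos_lbound arccos_ubound intro!: sin_ge_zero)
  have \<gamma>: "cos \<gamma> = \<sigma>" "0 < \<gamma>" "\<gamma> < pi / 2"
    using \<open>0 < \<sigma>\<close> \<open>\<sigma> < 1\<close> arccos_less_arccos[of 0 \<sigma>] arccos_less_arccos[of \<sigma> 1]
    by (auto simp: \<gamma>_def)
  \<comment> \<open>A product of two signed sines, nonnegative if the claim fails, so it equals the
    product of their absolute values.\<close>
  have "(l \<bullet> u - (l \<bullet> v) * (u \<bullet> v)) = sin (\<alpha> - \<delta>) * sin (\<beta> - \<delta>)"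
    unfolding dirs dirv_inner_dirv using cos_diff[of "\<alpha> - \<delta>" "\<beta> - \<delta>"] by simp
  moreover have "(sin (\<alpha> - \<delta>))\<^sup>2 = (sin A)\<^sup>2" "(sin (\<beta> - \<delta>))\<^sup>2 = (sin B)\<^sup>2"
    by (simp_all add: sin_squared_eq A(1) B(1)) (simp_all add: dirs dirv_inner_dirv)
  then have "\<bar>sin (\<alpha> - \<delta>)\<bar> = sin A" "\<bar>sin (\<beta> - \<delta>)\<bar> = sin B"
    using A(4) B(4) by (metis abs_of_nonneg real_sqrt_abs)+
  ultimately have "l \<bullet> u - (l \<bullet> v) * (u \<bullet> v) = sin A * sin B"
    using not by (metis abs_mult abs_of_nonneg diff_ge_0_iff_ge linorder_not_less)
  then have lu_eq: "l \<bullet> u = cos \<bar>A - B\<bar>" using A(1) B(1) by (simp add: cos_diff)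
  have "pi - \<gamma> < B"
  proof (rule ccontr)
    assume "\<not> ?thesis"
    then have "cos (pi - \<gamma>) \<le> cos B" using B \<gamma> by (intro cos_monotone_0_pi_le) auto
    then show False using B F \<gamma> by simp
  qed
  moreover have "B < 2 * \<gamma>"
  proof (rule ccontr)
    assume "\<not> ?thesis"
    then have "cos B \<le> cos (2 * \<gamma>)" using B \<gamma> by (intro cos_monotone_0_pi_le) auto
    then show False using B F \<gamma> by (simp add: cos_double_cos)
  qed
  moreover have "\<gamma> \<le> A"
  proof (rule ccontr)
    assume "\<not> ?thesis"
    then have "cos \<gamma> < cos A" using A \<gamma> by (intro cos_monotone_0_pi) auto
    then show False using lv A \<gamma> by simp
  qed
  ultimately have "\<bar>A - B\<bar> < \<gamma>" using A(3) by linarith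
  then have "cos \<gamma> < cos \<bar>A - B\<bar>" using \<gamma> by (intro cos_monotone_0_pi) auto
  then show False using lu lu_eq \<gamma> by simp
qed

text \<open>The integral of the cosine over an arc of fixed length \<open>pi / 2 - \<beta>\<close>
  is smallest when the midpoint is farthest from 0. The bounds on \<open>p\<close> keep the midpoint
  within \<open>pi / 4 + \<beta> / 2\<close> of 0, a distance reached at both extremes of
  \<open>p\<close>.\<close>

lemma sin_diff_ge:
  assumes "0 \<le> \<beta>" "\<beta> \<le> pi / 2" "- (pi / 2) \<le> p" "p \<le> \<beta>"
  shows "1 - sin \<beta> \<le> sin (p + pi / 2 - \<beta>) - sin p"
proof -
  have "1 - sin \<beta> = sin (pi / 2) - sin \<beta>" by simp
  also have "\<dots> = 2 * sin ((pi / 2 - \<beta>) / 2) * cos ((pi / 2 + \<beta>) / 2)" by (rule sin_diff_sin)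
  also have "\<dots> \<le> 2 * sin ((pi / 2 - \<beta>) / 2) * cos \<bar>(p + pi / 2 - \<beta> + p) / 2\<bar>"
    using assms by (intro mult_left_mono cos_monotone_0_pi_le mult_nonneg_nonneg sin_ge_zero) (auto simp: field_simps abs_le_iff)
  also have "cos \<bar>(p + pi / 2 - \<beta> + p) / 2\<bar> = cos ((p + pi / 2 - \<beta> + p) / 2)"
    unfolding abs_if by (simp only: cos_minus if_cancel split: if_split) simp
  also have "2 * sin ((pi / 2 - \<beta>) / 2) * \<dots> = sin (p + pi / 2 - \<beta>) - sin p"
    using sin_diff_sin[of "p + pi / 2 - \<beta>" p] by simp
  finally show ?thesis .
qed

text \<open>The directions in \<open>U\<close> fill a sector of opening at most
  \<open>pi / 2 + \<beta>\<close>, so its dual arc has length at least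
  \<open>pi / 2 - \<beta>\<close>. The quantity in the last claim is the integral of
  \<open>l \<bullet> dirv \<theta>\<close> over the chosen arc.\<close>

lemma wide_normal_arc:
  fixes U :: "(real ^ 2) set" and l :: "real ^ 2"
  assumes \<sigma>: "0 < \<sigma>" "\<sigma> < 1 / 2" and l: "norm l = 1"
    and lU: "\<And>w. w \<in> U \<Longrightarrow> l \<bullet> w \<le> \<sigma> * norm w"
    and UU: "\<And>w w'. w \<in> U \<Longrightarrow> w' \<in> U \<Longrightarrow> - \<sigma> * (norm w * norm w') \<le> w \<bullet> w'"
  obtains p q where "p \<le> q" "q \<le> p + 2 * pi"
    "\<And>\<theta> w. \<theta> \<in> {p..q} \<Longrightarrow> w \<in> U \<Longrightarrow> w \<bullet> dirv \<theta> \<le> 0"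
    "1 - \<sigma> \<le> l $ 1 * (sin q - sin p) + l $ 2 * (cos p - cos q)"
proof -
  obtain \<mu> where \<mu>: "l = dirv \<mu>" using unit_vector_dirv[OF l] by blast
  define \<beta> where "\<beta> = arcsin \<sigma>"
  have sin\<beta>: "sin \<beta> = \<sigma>" using \<sigma> by (simp add: \<beta>_def)
  have "arcsin (1 / 2) = pi / 6"
    using arcsin_sin[of "pi / 6"] by (simp add: sin_30)
  then have \<beta>: "0 < \<beta>" "\<beta> < pi / 6"
    using \<sigma> arcsin_less_arcsin[of 0 \<sigma>] arcsin_less_arcsin[of \<sigma> "1 / 2"] by (auto simp: \<beta>_def)
  \<comment> \<open>Measured from \<open>\<mu>\<close>, angles are cut at the direction of
    \<open>l\<close>, around which \<open>U\<close> has no directions; so they can be ordered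
    without wrapping around.\<close>
  define S where "S = {\<alpha>. 0 \<le> \<alpha> \<and> \<alpha> \<le> 2 * pi \<and> (\<exists>w\<in>U. w \<noteq> 0 \<and> w = norm w *\<^sub>R dirv (\<mu> + \<alpha>))}"
  have repr: "\<exists>\<alpha>\<in>S. w = norm w *\<^sub>R dirv (\<mu> + \<alpha>)" if w: "w \<in> U" "w \<noteq> 0" for w
  proof -
    have "norm ((1 / norm w) *\<^sub>R w) = 1" using w by simp
    then obtain \<theta> where \<theta>: "0 \<le> \<theta>" "\<theta> < 2 * pi" "(1 / norm w) *\<^sub>R w = dirv \<theta>"
      by (rule unit_vector_dirv)
    then have w_eq: "w = norm w *\<^sub>R dirv \<theta>" using w by (simp flip: \<theta>(3))
    obtain \<alpha> where \<alpha>: "0 \<le> \<alpha>" "\<alpha> < 2 * pi" "vector [cos (\<theta> - \<mu>), sin (\<theta> - \<mu>)] = dirv \<alpha>"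
      using unit_vector_dirv[of "dirv (\<theta> - \<mu>)"] unfolding dirv_def[of "\<theta> - \<mu>"] norm_dirv by (metis dirv_def norm_dirv)
    from \<alpha>(3) have cs: "cos \<alpha> = cos (\<theta> - \<mu>)" "sin \<alpha> = sin (\<theta> - \<mu>)"
      by (metis dirv_def dirv_nth)+
    have "cos \<theta> = cos (\<mu> + \<alpha>)" "sin \<theta> = sin (\<mu> + \<alpha>)"
      using cos_add[of \<mu> "\<theta> - \<mu>"] sin_add[of \<mu> "\<theta> - \<mu>"] by (simp_all add: cos_add sin_add cs)
    then have "dirv \<theta> = dirv (\<mu> + \<alpha>)" by (simp add: dirv_def)
    with w_eq have "w = norm w *\<^sub>R dirv (\<mu> + \<alpha>)" by simp
    then show ?thesis using \<alpha> w by (intro bexI[of _ \<alpha>]) (auto simp: S_def)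
  qed
  have S_range: "pi / 2 - \<beta> \<le> \<alpha>" "\<alpha> \<le> 3 * pi / 2 + \<beta>" if \<alpha>S: "\<alpha> \<in> S" for \<alpha>
  proof -
    obtain w where w: "w \<in> U" "w \<noteq> 0" "w = norm w *\<^sub>R dirv (\<mu> + \<alpha>)" and \<alpha>: "0 \<le> \<alpha>" "\<alpha> \<le> 2 * pi"
      using \<alpha>S by (auto simp: S_def)
    have "l \<bullet> w = norm w * cos \<alpha>"
      by (subst w(3)) (simp add: \<mu> dirv_inner_dirv)
    then have "cos \<alpha> \<le> \<sigma>" using lU[OF w(1)] w(2) by (simp add: mult.commute)
    moreover have "\<sigma> < cos \<alpha>'" if "0 \<le> \<alpha>'" "\<alpha>' < pi / 2 - \<beta>" for \<alpha>'
    proof -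
      have "cos (pi / 2 - \<beta>) < cos \<alpha>'" using that \<beta> by (intro cos_monotone_0_pi) auto
      then show ?thesis by (simp add: cos_diff sin\<beta>)
    qed
    from this[of \<alpha>] this[of "2 * pi - \<alpha>"]
    have "\<alpha> < pi / 2 - \<beta> \<Longrightarrow> \<sigma> < cos \<alpha>" "2 * pi - \<alpha> < pi / 2 - \<beta> \<Longrightarrow> \<sigma> < cos \<alpha>"
      using \<alpha> by (simp_all add: cos_diff)
    ultimately show "pi / 2 - \<beta> \<le> \<alpha>" "\<alpha> \<le> 3 * pi / 2 + \<beta>" by linarith+
  qed
  have S_width: "\<alpha> - \<alpha>' \<le> pi / 2 + \<beta>" if \<alpha>S: "\<alpha> \<in> S" and \<alpha>'S: "\<alpha>' \<in> S" for \<alpha> \<alpha>'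
  proof (rule ccontr)
    assume wide: "\<not> ?thesis"
    obtain w where w: "w \<in> U" "w \<noteq> 0" "w = norm w *\<^sub>R dirv (\<mu> + \<alpha>)"
      using \<alpha>S by (auto simp: S_def)
    obtain w' where w': "w' \<in> U" "w' \<noteq> 0" "w' = norm w' *\<^sub>R dirv (\<mu> + \<alpha>')"
      using \<alpha>'S by (auto simp: S_def)
    have "w \<bullet> w' = norm w * norm w' * cos (\<alpha> - \<alpha>')"
      by (subst w(3), subst w'(3)) (simp add: dirv_inner_dirv)
    then have "(norm w * norm w') * - \<sigma> \<le> (norm w * norm w') * cos (\<alpha> - \<alpha>')"
      using UU[OF w(1) w'(1)] by (simp add: mult.commute)
    then have ge: "- \<sigma> \<le> cos (\<alpha> - \<alpha>')" using w(2) w'(2) by (subst (asm) mult_le_cancel_left_pos) auto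
    have lt: "cos \<delta> < - \<sigma>" if "pi / 2 + \<beta> < \<delta>" "\<delta> \<le> pi" for \<delta>
    proof -
      have "cos \<delta> < cos (pi / 2 + \<beta>)" using that \<beta> by (intro cos_monotone_0_pi) auto
      then show ?thesis by (simp add: cos_add sin\<beta>)
    qed
    show False
    proof (cases "\<alpha> - \<alpha>' \<le> pi")
      case True
      then show ?thesis using lt[of "\<alpha> - \<alpha>'"] ge wide by simp
    next
      case False
      \<comment> \<open>A difference beyond \<open>pi\<close> is possible a priori. Its complement
        to \<open>2 * pi\<close> is then at least \<open>pi - 2 * \<beta>\<close>, which exceeds
        \<open>pi / 2 + \<beta>\<close> because \<open>\<beta> < pi / 6\<close>.\<close>
      have "\<alpha> - \<alpha>' \<le> pi + 2 * \<beta>" using S_range[OF \<alpha>S] S_range[OF \<alpha>'S] by simp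
      then have "cos (2 * pi - (\<alpha> - \<alpha>')) < - \<sigma>" using False \<beta> by (intro lt) auto
      then show ?thesis using ge by (simp add: cos_diff)
    qed
  qed
  obtain m M where mM: "\<And>\<alpha>. \<alpha> \<in> S \<Longrightarrow> m \<le> \<alpha> \<and> \<alpha> \<le> M" "M - m \<le> pi / 2 + \<beta>"
    "pi / 2 - \<beta> \<le> m" "M \<le> 3 * pi / 2 + \<beta>" "m \<le> M"
  proof (cases "S = {}")
    case True
    \<comment> \<open>Without nonzero vectors in \<open>U\<close>, as at the initial time, any
      interval within the bounds serves.\<close>
    then show ?thesis using \<beta> that[of pi pi] by simp
  next
    case False
    have bdd: "bdd_below S" "bdd_above S"
      by (rule bdd_belowI, erule S_range(1)) (rule bdd_aboveI, erule S_range(2))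
    have "Sup S \<le> pi / 2 + \<beta> + Inf S"
    proof (rule cSup_least[OF False])
      fix \<alpha> assume "\<alpha> \<in> S"
      have "\<alpha> - (pi / 2 + \<beta>) \<le> Inf S"
      proof (rule cInf_greatest[OF False])
        fix \<alpha>' assume "\<alpha>' \<in> S"
        then show "\<alpha> - (pi / 2 + \<beta>) \<le> \<alpha>'" using S_width[OF \<open>\<alpha> \<in> S\<close>, of \<alpha>'] by simp
      qed
      then show "\<alpha> \<le> pi / 2 + \<beta> + Inf S" by simp
    qed
    moreover have "Inf S \<le> \<alpha> \<and> \<alpha> \<le> Sup S" if "\<alpha> \<in> S" for \<alpha>
      using that bdd by (simp add: cInf_lower cSup_upper)
    moreover have "pi / 2 - \<beta> \<le> Inf S" using False S_range(1) by (rule cInf_greatest)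
    moreover have "Sup S \<le> 3 * pi / 2 + \<beta>" using False S_range(2) by (rule cSup_least)
    moreover have "Inf S \<le> Sup S" using False bdd by (intro cInf_le_cSup)
    ultimately show ?thesis by (intro that[of "Inf S" "Sup S"]) auto
  qed
  \<comment> \<open>Relative to \<open>\<mu>\<close>, all angles from \<open>M - 3 * pi / 2\<close>
    to \<open>m - pi / 2\<close> are normal. A sub-arc of length exactly
    \<open>pi / 2 - \<beta>\<close> is placed as far right as possible subject to
    \<open>p \<le> \<beta>\<close>, the range of \<open>sin_diff_ge\<close>.\<close>
  define p where "p = min \<beta> (m - pi + \<beta>)"
  define q where "q = p + pi / 2 - \<beta>"
  have pq: "p \<le> q" "q \<le> p + 2 * pi" "M - 3 * pi / 2 \<le> p" "q \<le> m - pi / 2" "p \<le> \<beta>" "- (pi / 2) \<le> p"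
    using mM \<beta> by (auto simp: p_def q_def min_def)
  show thesis
  proof (rule that)
    show "\<mu> + p \<le> \<mu> + q" "\<mu> + q \<le> \<mu> + p + 2 * pi" using pq by auto
  next
    fix \<theta> w assume \<theta>: "\<theta> \<in> {\<mu> + p..\<mu> + q}" and w: "w \<in> U"
    show "w \<bullet> dirv \<theta> \<le> 0"
    proof (cases "w = 0")
      case False
      then obtain \<alpha> where \<alpha>: "\<alpha> \<in> S" "w = norm w *\<^sub>R dirv (\<mu> + \<alpha>)" using repr[OF w] by blast
      define \<delta> where "\<delta> = \<theta> - (\<mu> + \<alpha>)"
      have "- (3 * pi / 2) \<le> \<delta>" "\<delta> \<le> - (pi / 2)"
        using \<theta> pq mM(1)[OF \<alpha>(1)] by (auto simp: \<delta>_def)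
      then have "0 \<le> cos (\<delta> + pi)" by (intro cos_ge_zero) auto
      then have "cos \<delta> \<le> 0" by simp
      moreover have "w \<bullet> dirv \<theta> = norm w * cos \<delta>"
        by (subst \<alpha>(2)) (use cos_minus[of \<delta>] in \<open>simp add: dirv_inner_dirv \<delta>_def\<close>)
      ultimately show ?thesis by (simp add: mult_nonneg_nonpos)
    qed simp
  next
    have "l $ 1 * (sin (\<mu> + q) - sin (\<mu> + p)) + l $ 2 * (cos (\<mu> + p) - cos (\<mu> + q))
        = sin (\<mu> + q - \<mu>) - sin (\<mu> + p - \<mu>)"
      unfolding sin_diff[of "\<mu> + q"] sin_diff[of "\<mu> + p"] by (simp add: \<mu> algebra_simps)
    also have "\<dots> = sin q - sin p" by simp
    also have "1 - \<sigma> \<le> \<dots>"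
      using sin_diff_ge[of \<beta> p] \<beta> pq by (simp add: q_def sin\<beta>)
    finally show "1 - \<sigma> \<le> l $ 1 * (sin (\<mu> + q) - sin (\<mu> + p)) + l $ 2 * (cos (\<mu> + p) - cos (\<mu> + q))" .
  qed
qed

section \<open>Length of R-paths\<close>

text \<open>The assumptions are chosen to pass to sub-arcs: a diameter bound replaces the disk
  around \<open>x0\<close>, and \<open>past_outside_ball\<close> is the squared form of
  \<open>R \<le> norm (g s - g t - R *\<^sub>R l)\<close>. \<open>\<sigma>\<close> stands for
  \<open>1 / (2 * N)\<close>.\<close>

locale r_curve =
  fixes g :: "real \<Rightarrow> real ^ 2" and a b R \<sigma> :: real
  assumes a_less_b: "a < b" and cont: "continuous_on {a..b} g" and inj: "inj_on g {a..b}"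
    and R: "0 < R" and \<sigma>: "0 < \<sigma>" "\<sigma> < 1 / 2"
    and diam: "\<And>s t. s \<in> {a..b} \<Longrightarrow> t \<in> {a..b} \<Longrightarrow> norm (g s - g t) \<le> 2 * R * \<sigma>"
    and past_outside_ball: "\<And>s t l. a \<le> s \<Longrightarrow> s \<le> t \<Longrightarrow> t < b \<Longrightarrow> norm l = 1 \<Longrightarrow>
      l \<in> tangent_cone (g ` {t..b}) (g t) \<Longrightarrow> 2 * R * (l \<bullet> (g s - g t)) \<le> (norm (g s - g t))\<^sup>2"
begin

lemma tangent_past_le:
  assumes "a \<le> s" "s \<le> t" "t < b" "norm l = 1" "l \<in> tangent_cone (g ` {t..b}) (g t)"
  shows "l \<bullet> (g s - g t) \<le> \<sigma> * norm (g s - g t)"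
proof -
  have "2 * R * (l \<bullet> (g s - g t)) \<le> norm (g s - g t) * norm (g s - g t)"
    using past_outside_ball[OF assms] by (simp add: power2_eq_square)
  also have "\<dots> \<le> (2 * R * \<sigma>) * norm (g s - g t)"
    using assms diam by (intro mult_right_mono) auto
  finally have "(2 * R) * (l \<bullet> (g s - g t)) \<le> (2 * R) * (\<sigma> * norm (g s - g t))"
    by (simp add: mult_ac)
  then show ?thesis using R by (subst (asm) mult_le_cancel_left_pos) auto
qed

lemma g_neq: "a \<le> s \<Longrightarrow> s < t \<Longrightarrow> t \<le> b \<Longrightarrow> g s \<noteq> g t"
  using inj_onD[OF inj, of s t] by auto

lemma continuous_on_g: "a \<le> s \<Longrightarrow> t \<le> b \<Longrightarrow> continuous_on {s..t} g"
  by (rule continuous_on_subset[OF cont]) auto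

section \<open>The angle under which two past points are seen\<close>

definition cos_angle :: "real \<Rightarrow> real \<Rightarrow> real \<Rightarrow> real" where
  "cos_angle s s' t = (g s - g t) \<bullet> (g s' - g t) / (norm (g s - g t) * norm (g s' - g t))"

text \<open>The lower bound on the cosine excludes that a tangent direction points between the two past
  points; the upper bound makes both lines of sight turn towards each other.\<close>
lemma cos_angle_locally_increasing:
  assumes "a \<le> s" "s < s'" "s' < t" "t < b"
    and range: "2 * \<sigma>\<^sup>2 - 1 < cos_angle s s' t" "cos_angle s s' t < - \<sigma>"
  shows "eventually (\<lambda>\<tau>. cos_angle s s' t \<le> cos_angle s s' \<tau>) (at_right t)"
proof -
  have "a \<le> t" "t < b" using assms by auto
  then have "eventually (\<lambda>\<tau>. 0 * norm (g \<tau> - g t) \<le> cos_angle s s' \<tau> - cos_angle s s' t) (at_right t)"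
  proof (rule eventually_growth_from_tangents[OF _ _ cont inj])
    fix l assume l: "norm l = 1" "l \<in> tangent_cone (g ` {t..b}) (g t)"
    let ?A = "norm (g s - g t)" and ?B = "norm (g s' - g t)"
    have nz: "g t \<noteq> g s" "g t \<noteq> g s'" using g_neq[of s t] g_neq[of s' t] assms by auto
    then have pos: "0 < ?A" "0 < ?B" by auto
    define u v where "u = (1 / ?A) *\<^sub>R (g s - g t)" and "v = (1 / ?B) *\<^sub>R (g s' - g t)"
    have unit: "norm u = 1" "norm v = 1" using pos by (simp_all add: u_def v_def)
    have uv: "u \<bullet> v = cos_angle s s' t" by (simp add: u_def v_def cos_angle_def)
    have "l \<bullet> u = l \<bullet> (g s - g t) / ?A" by (simp add: u_def)
    have "l \<bullet> v = l \<bullet> (g s' - g t) / ?B" by (simp add: v_def)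
    have le: "l \<bullet> u \<le> \<sigma>" "l \<bullet> v \<le> \<sigma>"
      using tangent_past_le[of s t l] tangent_past_le[of s' t l] l assms pos
      by (simp_all add: \<open>l \<bullet> u = _\<close> \<open>l \<bullet> v = _\<close> divide_le_eq)
    have "l \<bullet> u < (l \<bullet> v) * (u \<bullet> v)" "l \<bullet> v < (l \<bullet> u) * (u \<bullet> v)"
      using planar_unit_inner_lt[OF l(1) unit \<sigma>(1) le] planar_unit_inner_lt[OF l(1) unit(2,1) \<sigma>(1) le(2,1)]
        range by (simp_all add: uv inner_commute[of v u])
    then have growth: "0 < ((u \<bullet> v) * (l \<bullet> u) - l \<bullet> v) / ?A + ((u \<bullet> v) * (l \<bullet> v) - l \<bullet> u) / ?B"
      using pos by (intro add_pos_pos divide_pos_pos) (auto simp: mult.commute)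
    show "\<exists>\<Phi> L. (\<Phi> has_derivative L) (at (g t)) \<and> 0 < L l \<and>
        (\<forall>\<tau>. t < \<tau> \<longrightarrow> \<tau> \<le> b \<longrightarrow> \<Phi> (g \<tau>) - \<Phi> (g t) \<le> cos_angle s s' \<tau> - cos_angle s s' t)"
      by (intro exI conjI, rule has_derivative_cos_angle[OF nz])
        (use growth in \<open>simp_all add: cos_angle_def uv \<open>l \<bullet> u = _\<close> \<open>l \<bullet> v = _\<close>\<close>)
  qed
  then show ?thesis by simp
qed

text \<open>Shortly after \<open>s'\<close>, the point \<open>g s'\<close> is seen nearly opposite
  to a forward tangent direction at \<open>s'\<close>, whose inner product with the direction to
  \<open>g s\<close> is at most \<open>\<sigma>\<close>. As the direction of sight may fail to
  converge, the bound comes from the growth of the linear function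
  \<open>- (w s' \<bullet> x)\<close>.\<close>

lemma cos_angle_initially:
  assumes "a \<le> s" "s < s'" "s' < b" "c < - \<sigma>"
  shows "eventually (\<lambda>\<tau>. c < cos_angle s s' \<tau>) (at_right s')"
proof -
  define w where "w \<tau> = (1 / norm (g s - g \<tau>)) *\<^sub>R (g s - g \<tau>)" for \<tau>
  \<comment> \<open>One \<open>e\<close> is lost to the strict rate of growth and one to replacing
    \<open>w s'\<close> by \<open>w \<tau>\<close>; the third is slack.\<close>
  define e where "e = (- \<sigma> - c) / 3"
  have "0 < e" using assms by (simp add: e_def)
  have nz: "g s \<noteq> g s'" using g_neq[of s s'] assms by auto
  have "eventually (\<lambda>\<tau>. - (\<sigma> + e) * norm (g \<tau> - g s') \<le> - (w s' \<bullet> g \<tau>) - - (w s' \<bullet> g s')) (at_right s')"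
  proof (rule eventually_growth_from_tangents[OF _ _ cont inj])
    fix l assume l: "norm l = 1" "l \<in> tangent_cone (g ` {s'..b}) (g s')"
    have "w s' \<bullet> l = l \<bullet> (g s - g s') / norm (g s - g s')" by (simp add: w_def inner_commute)
    also have "\<dots> \<le> \<sigma>"
      using tangent_past_le[of s s' l] l assms nz by (simp add: divide_le_eq)
    finally have "- (\<sigma> + e) < - (w s' \<bullet> l)" using \<open>0 < e\<close> by simp
    moreover have "((\<lambda>x. - (w s' \<bullet> x)) has_derivative (\<lambda>h. - (w s' \<bullet> h))) (at (g s'))"
      by (auto intro!: derivative_eq_intros)
    ultimately show "\<exists>\<Phi> L. (\<Phi> has_derivative L) (at (g s')) \<and> - (\<sigma> + e) < L l \<and>
        (\<forall>\<tau>. s' < \<tau> \<longrightarrow> \<tau> \<le> b \<longrightarrow> \<Phi> (g \<tau>) - \<Phi> (g s') \<le> - (w s' \<bullet> g \<tau>) - - (w s' \<bullet> g s'))"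
      by (intro exI conjI) auto
  qed (use assms in auto)
  moreover have "eventually (\<lambda>\<tau>. norm (w \<tau> - w s') < e) (at_right s')"
  proof -
    have "(g \<longlongrightarrow> g s') (at_right s')"
      using continuous_on_Icc_at_rightD[OF continuous_on_g[of s' b]] assms by simp
    then have "(w \<longlongrightarrow> w s') (at_right s')"
      unfolding w_def using nz by (intro tendsto_intros) auto
    from tendstoD[OF this \<open>0 < e\<close>] show ?thesis by (simp add: dist_norm)
  qed
  moreover have "eventually (\<lambda>\<tau>. s' < \<tau> \<and> \<tau> < b) (at_right s')"
    using assms eventually_at_right[of s' b] by auto
  ultimately show ?thesis
  proof eventually_elim
    case (elim \<tau>)
    have nz': "g s' \<noteq> g \<tau>" "g s \<noteq> g \<tau>" using g_neq[of s' \<tau>] g_neq[of s \<tau>] assms elim by auto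
    define z where "z = (1 / norm (g s' - g \<tau>)) *\<^sub>R (g s' - g \<tau>)"
    have "norm z = 1" using nz' by (simp add: z_def)
    have "- (\<sigma> + e) * norm (g s' - g \<tau>) \<le> w s' \<bullet> (g s' - g \<tau>)"
      using elim(1) by (simp add: inner_diff_right norm_minus_commute)
    then have "- (\<sigma> + e) \<le> w s' \<bullet> z"
      using nz' by (simp add: z_def le_divide_eq)
    moreover have "\<bar>(w \<tau> - w s') \<bullet> z\<bar> \<le> norm (w \<tau> - w s') * norm z" by (rule Cauchy_Schwarz_ineq2)
    then have "- e < (w \<tau> - w s') \<bullet> z" using elim(2) \<open>norm z = 1\<close> by simp
    moreover have "cos_angle s s' \<tau> = w \<tau> \<bullet> z" by (simp add: cos_angle_def w_def z_def)
    ultimately have "- \<sigma> - 2 * e < cos_angle s s' \<tau>" by (simp add: inner_diff_left)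
    then show ?case using \<open>0 < e\<close> by (simp add: e_def field_simps)
  qed
qed

text \<open>If the cosine ended below \<open>- \<sigma>\<close>, take a level \<open>c\<close> above
  its final value and inside the window of \<open>cos_angle_locally_increasing\<close>. At the last
  time \<open>m\<close> at which the cosine is at least \<open>c\<close> it equals \<open>c\<close>,
  yet it stays at least \<open>c\<close> just afterwards, a contradiction.\<close>

lemma cos_angle_ge:
  assumes "a \<le> s" "s < s'" "s' < t" "t \<le> b"
  shows "- \<sigma> \<le> cos_angle s s' t"
proof (rule ccontr)
  assume "\<not> ?thesis"
  moreover have "2 * \<sigma>\<^sup>2 - 1 < - \<sigma>"
  proof -
    have "(2 * \<sigma> - 1) * (\<sigma> + 1) < 0" using \<sigma> by (intro mult_neg_pos) auto
    then show ?thesis by (simp add: algebra_simps power2_eq_square)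
  qed
  ultimately have "max (cos_angle s s' t) (2 * \<sigma>\<^sup>2 - 1) < - \<sigma>" by simp
  from dense[OF this] obtain c where c: "cos_angle s s' t < c" "2 * \<sigma>\<^sup>2 - 1 < c" "c < - \<sigma>" by auto
  have "eventually (\<lambda>\<tau>. c < cos_angle s s' \<tau>) (at_right s')"
    using cos_angle_initially[of s s' c] assms c by auto
  then obtain d where d: "s' < d" "\<And>\<tau>. s' < \<tau> \<Longrightarrow> \<tau> < d \<Longrightarrow> c < cos_angle s s' \<tau>"
    using eventually_at_right[OF assms(3)] by auto
  \<comment> \<open>At \<open>s'\<close> itself \<open>cos_angle\<close> is the default value 0 of a
    division by zero, so continuity is claimed only from a later time \<open>\<tau>0\<close>
    on.\<close>
  obtain \<tau>0 where \<tau>0: "s' < \<tau>0" "\<tau>0 < min d t" using dense[of s' "min d t"] d assms by auto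
  have cont_angle: "continuous_on {\<tau>0..t} (cos_angle s s')"
    unfolding cos_angle_def using assms \<tau>0 g_neq[of s] g_neq[of s']
    by (intro continuous_intros continuous_on_g) auto
  define S where "S = {\<tau> \<in> {\<tau>0..t}. c \<le> cos_angle s s' \<tau>}"
  have "closed S"
    unfolding S_def using continuous_on_closed_Collect_le[OF continuous_on_const cont_angle]
    by simp
  moreover have "S \<subseteq> {\<tau>0..t}" by (auto simp: S_def)
  ultimately have "compact S" using compact_Icc closed_subset by (metis compact_Int_closed inf.absorb_iff2)
  moreover have "\<tau>0 \<in> S" using \<tau>0 d(2)[of \<tau>0] by (auto simp: S_def)
  ultimately obtain m where m: "m \<in> S" "\<And>\<tau>. \<tau> \<in> S \<Longrightarrow> \<tau> \<le> m"
    using compact_attains_sup[of S] by blast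
  have "m < t" using m c(1) by (auto simp: S_def less_le)
  have "cos_angle s s' m \<le> c"
  proof (rule ccontr)
    assume above: "\<not> ?thesis"
    then obtain x where "m \<le> x" "x \<le> t" "cos_angle s s' x = c"
      using IVT2'[of "cos_angle s s'" t c m] continuous_on_subset[OF cont_angle] c(1) m(1) \<open>m < t\<close>
      by (auto simp: S_def)
    moreover from this have "x \<in> S" using m(1) by (auto simp: S_def)
    ultimately show False using m(2)[of x] above by auto
  qed
  then have "cos_angle s s' m = c" using m by (auto simp: S_def)
  then have "eventually (\<lambda>\<tau>. c \<le> cos_angle s s' \<tau>) (at_right m)"
    using cos_angle_locally_increasing[of s s' m] assms c m \<tau>0 \<open>m < t\<close> by (auto simp: S_def)
  then obtain d' where d': "m < d'" "\<And>\<tau>. m < \<tau> \<Longrightarrow> \<tau> < d' \<Longrightarrow> c \<le> cos_angle s s' \<tau>"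
    using eventually_at_right[OF \<open>m < t\<close>] by auto
  obtain \<tau> where "m < \<tau>" "\<tau> < min d' t" using dense[of m "min d' t"] d' \<open>m < t\<close> by auto
  moreover from this have "\<tau> \<in> S" using d' m by (auto simp: S_def)
  ultimately show False using m(2)[of \<tau>] by simp
qed

text \<open>With denominators cleared, the bound also covers coinciding times.\<close>

lemma past_pair_inner_ge:
  assumes "s \<in> {a..t}" "s' \<in> {a..t}" "t \<le> b"
  shows "- \<sigma> * (norm (g s - g t) * norm (g s' - g t)) \<le> (g s - g t) \<bullet> (g s' - g t)"
proof -
  have *: "- \<sigma> * (norm (g s - g t) * norm (g s' - g t)) \<le> (g s - g t) \<bullet> (g s' - g t)" if less: "s < s'" "s' < t" and "a \<le> s" for s s'
  proof -
    have "0 < norm (g s - g t) * norm (g s' - g t)"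
      using g_neq[of s t] g_neq[of s' t] assms that by simp
    then show ?thesis
      using cos_angle_ge[of s s' t] that assms by (simp add: cos_angle_def le_divide_eq)
  qed
  consider "s = t" | "s' = t" | "s = s'" | "s < s'" "s' < t" | "s' < s" "s < t"
    using assms by force
  then show ?thesis
  proof cases
    case 3
    have "- \<sigma> * (norm (g s - g t) * norm (g s - g t)) \<le> 0"
      using \<sigma> by (simp add: mult_nonneg_nonneg)
    also have "0 \<le> (g s - g t) \<bullet> (g s - g t)" by simp
    finally show ?thesis unfolding 3 .
  next
    case 4
    then show ?thesis using *[of s s'] assms by simp
  next
    case 5
    then show ?thesis using *[of s' s] assms by (simp add: inner_commute mult.commute)
  qed simp_all
qed

section \<open>Growth of the perimeter of the past\<close>

definition past_perimeter :: "real \<Rightarrow> real" where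
  "past_perimeter t = cauchy_perimeter (g ` {a..t})"

lemma bounded_past: "t \<le> b \<Longrightarrow> bounded (g ` {a..t})"
  by (intro compact_imp_bounded compact_continuous_image continuous_on_g) auto

lemma mono_on_past_perimeter: "mono_on {a..b} past_perimeter"
  unfolding past_perimeter_def
  by (intro mono_onI cauchy_perimeter_mono bounded_past) auto

text \<open>For a forward tangent \<open>l\<close> the test function is the inner product with
  \<open>V\<close>, the integral of \<open>dirv\<close> over the arc of
  \<open>wide_normal_arc\<close>. \<open>cauchy_perimeter_growth\<close> dominates its increments at
  all later times, and its slope \<open>l \<bullet> V\<close> is at least
  \<open>1 - \<sigma>\<close>.\<close>

lemma past_perimeter_locally_increasing:
  assumes "a \<le> t" "t < b" "\<kappa> < 1 - \<sigma>"
  shows "eventually (\<lambda>s. \<kappa> * norm (g s - g t) \<le> past_perimeter s - past_perimeter t) (at_right t)"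
proof (rule eventually_growth_from_tangents[OF assms(1,2) cont inj])
  fix l assume l: "norm l = 1" "l \<in> tangent_cone (g ` {t..b}) (g t)"
  obtain p q where pq: "p \<le> q" "q \<le> p + 2 * pi"
    "\<And>\<theta> w. \<theta> \<in> {p..q} \<Longrightarrow> w \<in> (\<lambda>s. g s - g t) ` {a..t} \<Longrightarrow> w \<bullet> dirv \<theta> \<le> 0"
    "1 - \<sigma> \<le> l $ 1 * (sin q - sin p) + l $ 2 * (cos p - cos q)"
  proof (rule wide_normal_arc[OF \<sigma> l(1)])
    show "l \<bullet> w \<le> \<sigma> * norm w" if "w \<in> (\<lambda>s. g s - g t) ` {a..t}" for w
      using that assms tangent_past_le[of _ t l] l by auto
    show "- \<sigma> * (norm w * norm w') \<le> w \<bullet> w'"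
      if "w \<in> (\<lambda>s. g s - g t) ` {a..t}" "w' \<in> (\<lambda>s. g s - g t) ` {a..t}" for w w'
      using that assms past_pair_inner_ge[of _ t] by fastforce
  qed blast
  define V :: "real ^ 2" where "V = vector [sin q - sin p, cos p - cos q]"
  have V: "x \<bullet> V = x $ 1 * (sin q - sin p) + x $ 2 * (cos p - cos q)" for x
    by (simp add: inner_vec_def sum_2 V_def)
  show "\<exists>\<Phi> L. (\<Phi> has_derivative L) (at (g t)) \<and> \<kappa> < L l \<and>
      (\<forall>s. t < s \<longrightarrow> s \<le> b \<longrightarrow> \<Phi> (g s) - \<Phi> (g t) \<le> past_perimeter s - past_perimeter t)"
  proof (intro exI conjI allI impI)
    show "((\<lambda>x. x \<bullet> V) has_derivative (\<lambda>h. h \<bullet> V)) (at (g t))"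
      by (auto intro!: derivative_eq_intros)
    show "\<kappa> < l \<bullet> V" using pq(4) assms(3) by (simp add: V)
  next
    fix s assume s: "t < s" "s \<le> b"
    have "(g s - g t) \<bullet> V \<le> past_perimeter s - past_perimeter t"
      unfolding V past_perimeter_def
    proof (rule cauchy_perimeter_growth[OF bounded_past])
      show "(y - g t) \<bullet> dirv \<theta> \<le> 0" if "\<theta> \<in> {p..q}" "y \<in> g ` {a..t}" for \<theta> y
        using pq(3)[OF that(1), of "y - g t"] that(2) by blast
    qed (use s assms pq in auto)
    then show "g s \<bullet> V - g t \<bullet> V \<le> past_perimeter s - past_perimeter t"
      by (simp add: inner_diff_left)
  qed
qed

text \<open>By the triangle inequality the local bound on the step from \<open>g t\<close> to
  \<open>g s\<close> also bounds the increase of the distance to the fixed point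
  \<open>g t1\<close>, which is continuous in time.\<close>

lemma dist_le_past_perimeter:
  assumes "a \<le> t1" "t1 \<le> t2" "t2 \<le> b" "0 \<le> \<kappa>" "\<kappa> < 1 - \<sigma>"
  shows "\<kappa> * norm (g t2 - g t1) \<le> past_perimeter t2 - past_perimeter t1"
proof -
  have "- (\<kappa> * norm (g t1 - g t1)) + past_perimeter t1 \<le> - (\<kappa> * norm (g t2 - g t1)) + past_perimeter t2"
  proof (rule continuous_plus_mono_growth[OF assms(2)])
    show "continuous_on {t1..t2} (\<lambda>s. - (\<kappa> * norm (g s - g t1)))"
      using assms by (intro continuous_intros continuous_on_g)
    show "mono_on {t1..t2} past_perimeter"
      using mono_on_subset[OF mono_on_past_perimeter] assms by auto
  next
    fix t assume t: "t1 \<le> t" "t < t2"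
    have "eventually (\<lambda>s. \<kappa> * norm (g s - g t) \<le> past_perimeter s - past_perimeter t) (at_right t)"
      using assms t by (intro past_perimeter_locally_increasing) auto
    then show "eventually (\<lambda>s. - (\<kappa> * norm (g t - g t1)) + past_perimeter t
        \<le> - (\<kappa> * norm (g s - g t1)) + past_perimeter s) (at_right t)"
    proof eventually_elim
      case (elim s)
      have "\<kappa> * norm (g s - g t1) \<le> \<kappa> * (norm (g s - g t) + norm (g t - g t1))"
        using norm_triangle_ineq[of "g s - g t" "g t - g t1"] assms by (intro mult_left_mono) auto
      then show ?case using elim by (simp add: distrib_left)
    qed
  qed
  then show ?thesis by simp
qed

lemma past_perimeter_start: "past_perimeter a = 0"
  by (simp add: past_perimeter_def cauchy_perimeter_def support_def integral_inner_dirv_period)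

lemma curve_length_le_past_perimeter:
  assumes "0 < \<kappa>" "\<kappa> < 1 - \<sigma>"
  shows "curve_length g a b \<le> ennreal (past_perimeter b / \<kappa>)"
  unfolding curve_length_def
proof (rule SUP_least)
  fix x assume "x \<in> {(n :: nat, t). mono_on {..n} t \<and> t 0 = a \<and> t n = b}"
  then obtain n t where x: "x = (n, t)" and t: "mono_on {..n} t" "t 0 = a" "t n = b" by auto
  have t_range: "a \<le> t i" "t i \<le> b" if "i \<le> n" for i
    using monotone_onD[OF t(1), of 0 i] monotone_onD[OF t(1), of i n] that t by auto
  have "\<kappa> * (\<Sum>i<n. dist (g (t i)) (g (t (Suc i))))
      \<le> (\<Sum>i<n. past_perimeter (t (Suc i)) - past_perimeter (t i))"
    unfolding sum_distrib_left
  proof (rule sum_mono)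
    fix i assume "i \<in> {..<n}"
    then have "t i \<le> t (Suc i)" using monotone_onD[OF t(1), of i "Suc i"] by auto
    then show "\<kappa> * dist (g (t i)) (g (t (Suc i))) \<le> past_perimeter (t (Suc i)) - past_perimeter (t i)"
      using dist_le_past_perimeter[of "t i" "t (Suc i)" \<kappa>] t_range[of i] t_range[of "Suc i"] assms \<open>i \<in> _\<close>
      by (simp add: dist_norm norm_minus_commute)
  qed
  also have "\<dots> = past_perimeter b"
    using sum_lessThan_telescope[of "\<lambda>i. past_perimeter (t i)" n]
    by (simp add: past_perimeter_start t(2,3))
  finally have "(\<Sum>i<n. dist (g (t i)) (g (t (Suc i)))) \<le> past_perimeter b / \<kappa>"
    using assms by (simp add: le_divide_eq mult.commute)
  then show "(case x of (n, t) \<Rightarrow> ennreal (\<Sum>i<n. dist (g (t i)) (g (t (Suc i)))))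
      \<le> ennreal (past_perimeter b / \<kappa>)"
    unfolding x case_prod_conv by (rule ennreal_leI)
qed

section \<open>Comparison of the length with the chord\<close>

lemma ln_dist_locally_increasing:
  assumes "a < t" "t < b"
  shows "eventually (\<lambda>s. - (1 / R) * norm (g s - g t) \<le> ln (norm (g a - g s)) - ln (norm (g a - g t))) (at_right t)"
proof (rule eventually_growth_from_tangents[OF _ assms(2) cont inj])
  fix l assume l: "norm l = 1" "l \<in> tangent_cone (g ` {t..b}) (g t)"
  have nz: "g t \<noteq> g a" using g_neq[of a t] assms by auto
  have "2 * R * (l \<bullet> (g a - g t)) \<le> (norm (g a - g t))\<^sup>2"
    using past_outside_ball[of a t l] assms l by auto
  then have "l \<bullet> (g a - g t) / (norm (g a - g t))\<^sup>2 \<le> 1 / (2 * R)"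
    using nz R by (simp add: divide_simps mult_ac)
  \<comment> \<open>The ball condition gives the slope bound \<open>- 1 / (2 * R)\<close>; the
    factor 2 is given away for the strict inequality of the tangent test.\<close>
  also have "\<dots> < 1 / R" using R by (simp add: divide_simps)
  finally have growth: "- (1 / R) < - (l \<bullet> (g a - g t)) / (norm (g a - g t))\<^sup>2" by simp
  show "\<exists>\<Phi> L. (\<Phi> has_derivative L) (at (g t)) \<and> - (1 / R) < L l \<and>
      (\<forall>s. t < s \<longrightarrow> s \<le> b \<longrightarrow> \<Phi> (g s) - \<Phi> (g t) \<le> ln (norm (g a - g s)) - ln (norm (g a - g t)))"
    by (intro exI conjI, rule has_derivative_ln_dist[OF nz], rule growth) simp
qed (use assms in auto)

text \<open>The logarithm of the distance to \<open>g a\<close> falls at rate at most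
  \<open>1 / R\<close> while the perimeter grows at rate at least \<open>\<kappa>\<close>, so the
  logarithm plus \<open>past_perimeter / (R * \<kappa>)\<close> never decreases. The total perimeter
  is at most \<open>2 * pi * R\<close>, since the curve stays within
  \<open>2 * R * \<sigma> \<le> R\<close> of \<open>g a\<close>.\<close>

lemma dist_start_le:
  assumes "t \<in> {a..b}" and \<kappa>: "0 < \<kappa>" "\<kappa> < 1 - \<sigma>"
  shows "norm (g t - g a) \<le> exp (2 * pi / \<kappa>) * norm (g b - g a)"
proof (cases "t = a")
  case False
  then have t: "a < t" "t \<le> b" using assms by auto
  have "ln (norm (g a - g t)) + past_perimeter t / (R * \<kappa>) \<le> ln (norm (g a - g b)) + past_perimeter b / (R * \<kappa>)"
  proof (rule continuous_plus_mono_growth[OF t(2)])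
    show "continuous_on {t..b} (\<lambda>s. ln (norm (g a - g s)))"
      using t g_neq[of a] by (intro continuous_intros continuous_on_g) auto
    show "mono_on {t..b} (\<lambda>s. past_perimeter s / (R * \<kappa>))"
      using mono_onD[OF mono_on_past_perimeter] t R \<kappa> by (intro mono_onI divide_right_mono) auto
  next
    fix s assume s: "t \<le> s" "s < b"
    have "eventually (\<lambda>\<tau>. - (1 / R) * norm (g \<tau> - g s) \<le> ln (norm (g a - g \<tau>)) - ln (norm (g a - g s))) (at_right s)"
      by (rule ln_dist_locally_increasing) (use s t in auto)
    moreover have "eventually (\<lambda>\<tau>. \<kappa> * norm (g \<tau> - g s) \<le> past_perimeter \<tau> - past_perimeter s) (at_right s)"
      by (rule past_perimeter_locally_increasing) (use s t \<kappa> in auto)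
    ultimately show "eventually (\<lambda>\<tau>. ln (norm (g a - g s)) + past_perimeter s / (R * \<kappa>)
        \<le> ln (norm (g a - g \<tau>)) + past_perimeter \<tau> / (R * \<kappa>)) (at_right s)"
    proof eventually_elim
      case (elim \<tau>)
      have "1 / R * norm (g \<tau> - g s) = \<kappa> * norm (g \<tau> - g s) / (R * \<kappa>)" using \<kappa> by simp
      also have "\<dots> \<le> (past_perimeter \<tau> - past_perimeter s) / (R * \<kappa>)"
        using elim(2) R \<kappa> by (intro divide_right_mono) auto
      finally show ?case using elim(1) by (simp add: diff_divide_distrib)
    qed
  qed
  moreover have "(past_perimeter b - past_perimeter t) / (R * \<kappa>) \<le> 2 * pi / \<kappa>"
  proof -
    have "past_perimeter a \<le> past_perimeter t"
      using t by (intro mono_onD[OF mono_on_past_perimeter]) auto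
    moreover have "past_perimeter b \<le> 2 * pi * (2 * R * \<sigma>)"
      unfolding past_perimeter_def
      using a_less_b diam by (intro cauchy_perimeter_le_radius[of "g a"]) auto
    moreover have "2 * pi * (2 * R * \<sigma>) \<le> 2 * pi * R"
      using R \<sigma> by (intro mult_left_mono) auto
    ultimately have "past_perimeter b - past_perimeter t \<le> 2 * pi * R"
      using past_perimeter_start by linarith
    then have "(past_perimeter b - past_perimeter t) / (R * \<kappa>) \<le> 2 * pi * R / (R * \<kappa>)"
      using R \<kappa> by (intro divide_right_mono) auto
    also have "\<dots> = 2 * pi / \<kappa>" using R by simp
    finally show ?thesis .
  qed
  ultimately have "ln (norm (g a - g t)) \<le> ln (norm (g a - g b)) + 2 * pi / \<kappa>"
    by (simp add: diff_divide_distrib)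
  then have "exp (ln (norm (g a - g t))) \<le> exp (ln (norm (g a - g b)) + 2 * pi / \<kappa>)" by simp
  moreover have "g a \<noteq> g t" "g a \<noteq> g b" using g_neq[of a t] g_neq[of a b] t a_less_b by auto
  ultimately show ?thesis
    by (simp add: exp_add norm_minus_commute mult.commute)
qed simp

lemma curve_length_le_chord:
  assumes "0 < \<kappa>" "\<kappa> < 1 - \<sigma>"
  shows "curve_length g a b \<le> ennreal (2 * pi / \<kappa> * exp (2 * pi / \<kappa>) * dist (g a) (g b))"
proof -
  have "past_perimeter b \<le> 2 * pi * (exp (2 * pi / \<kappa>) * norm (g b - g a))"
    unfolding past_perimeter_def
    using a_less_b dist_start_le assms by (intro cauchy_perimeter_le_radius[of "g a"]) auto
  then have "past_perimeter b / \<kappa> \<le> 2 * pi / \<kappa> * exp (2 * pi / \<kappa>) * dist (g a) (g b)"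
    using assms by (simp add: divide_simps dist_norm norm_minus_commute mult_ac)
  then show ?thesis
    using curve_length_le_past_perimeter[OF assms] by (meson ennreal_leI order_trans)
qed

text \<open>A shorter future has fewer tangent directions and a shorter past fewer points, so the
  chord estimate between endpoints applies to any two times with the same
  \<open>\<sigma>\<close>.\<close>

lemma restrict:
  assumes "a \<le> t1" "t1 < t2" "t2 \<le> b"
  shows "r_curve g t1 t2 R \<sigma>"
proof
  fix s t l
  assume st: "t1 \<le> s" "s \<le> t" "t < t2" "norm l = 1" "l \<in> tangent_cone (g ` {t..t2}) (g t)"
  have "tangent_cone (g ` {t..t2}) (g t) \<subseteq> tangent_cone (g ` {t..b}) (g t)"
    using assms unfolding tangent_cone_def by fastforce
  then show "2 * R * (l \<bullet> (g s - g t)) \<le> (norm (g s - g t))\<^sup>2"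
    using st assms by (intro past_outside_ball) auto
qed (use assms R \<sigma> diam inj in \<open>auto intro: continuous_on_g inj_on_subset\<close>)

end

section \<open>From R-paths to the locale, and the conclusion\<close>

lemma inner_le_of_notin_ball:
  fixes l :: "'a::real_inner"
  assumes "norm l = 1" "0 < R" "y \<notin> ball (x + R *\<^sub>R l) R"
  shows "2 * R * (l \<bullet> (y - x)) \<le> (norm (y - x))\<^sup>2"
proof -
  define w where "w = y - x"
  have "R \<le> norm (w - R *\<^sub>R l)"
    using assms(3) by (simp add: w_def dist_norm norm_minus_commute algebra_simps)
  then have "R\<^sup>2 \<le> (norm (w - R *\<^sub>R l))\<^sup>2" using assms(2) by (intro power_mono) auto
  also have "\<dots> = (norm w)\<^sup>2 - 2 * R * (l \<bullet> w) + R\<^sup>2 * (l \<bullet> l)"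
    unfolding power2_norm_eq_inner
    by (simp add: inner_diff_left inner_diff_right inner_commute power2_eq_square algebra_simps)
  finally show ?thesis using assms(1) by (simp add: w_def norm_eq_1)
qed

theorem theorem4p10:
  shows "\<exists>c :: real \<Rightarrow> real. \<forall>N :: real. N > 1 \<longrightarrow>
    (let \<phi> = pi / 2 + 2 * arcsin (1 / (2 * N)) in
      \<forall>R > 0. \<forall>x0 :: real ^ 2. \<forall>(g :: real \<Rightarrow> real ^ 2) a b.
        R_path R g a b \<and> inj_on g {a..b} \<and> g ` {a..b} \<subseteq> cball x0 (R / (2 * N)) \<longrightarrow>
          rectifiable_curve g a b \<and>
          curve_length g a b \<le> perimeter (convex hull (g ` {a..b})) / ennreal (1 + cos \<phi>) \<and>
          (\<forall>t1 t2. a \<le> t1 \<and> t1 < t2 \<and> t2 \<le> b \<longrightarrow>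
             curve_length g t1 t2 / ennreal (dist (g t1) (g t2)) \<le> ennreal (c \<phi>)))"
\<comment> \<open>The witness is the factor in \<open>curve_length_le_chord\<close> with
  \<open>1 + cos \<phi>\<close> for \<open>\<kappa>\<close>.\<close>
proof (intro exI[of _ "\<lambda>\<phi>. 2 * pi / (1 + cos \<phi>) * exp (2 * pi / (1 + cos \<phi>))"] allI impI, unfold Let_def, intro allI impI)
  fix N R :: real and x0 :: "real ^ 2" and g :: "real \<Rightarrow> real ^ 2" and a b :: real
  assume N: "1 < N" and R: "0 < R"
    and g: "R_path R g a b \<and> inj_on g {a..b} \<and> g ` {a..b} \<subseteq> cball x0 (R / (2 * N))"
  define \<sigma> where "\<sigma> = 1 / (2 * N)"
  define \<kappa> where "\<kappa> = 1 + cos (pi / 2 + 2 * arcsin (1 / (2 * N)))"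
  have \<sigma>: "0 < \<sigma>" "\<sigma> < 1 / 2" using N by (auto simp: \<sigma>_def field_simps)
  have \<kappa>_eq: "\<kappa> = 1 - 2 * \<sigma> * sqrt (1 - \<sigma>\<^sup>2)"
    using \<sigma> by (simp add: \<kappa>_def cos_add sin_double cos_arcsin flip: \<sigma>_def)
  have sq: "\<sigma>\<^sup>2 < (1 / 2)\<^sup>2" using \<sigma> by (intro power_strict_mono) auto
  have sqrt: "1 / 2 < sqrt (1 - \<sigma>\<^sup>2)" "sqrt (1 - \<sigma>\<^sup>2) \<le> 1"
  proof -
    show "1 / 2 < sqrt (1 - \<sigma>\<^sup>2)"
      by (rule real_less_rsqrt) (use sq in \<open>simp add: power2_eq_square\<close>)
  qed simp
  have \<kappa>: "0 < \<kappa>" "\<kappa> < 1 - \<sigma>"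
  proof -
    have "2 * \<sigma> * sqrt (1 - \<sigma>\<^sup>2) \<le> 2 * \<sigma> * 1" using \<sigma> sqrt by (intro mult_left_mono) auto
    then show "0 < \<kappa>" using \<sigma> unfolding \<kappa>_eq by linarith
    have "2 * \<sigma> * (1 / 2) < 2 * \<sigma> * sqrt (1 - \<sigma>\<^sup>2)" using \<sigma> sqrt by (intro mult_strict_left_mono) auto
    then show "\<kappa> < 1 - \<sigma>" by (simp add: \<kappa>_eq)
  qed
  interpret r_curve g a b R \<sigma>
  proof
    show "norm (g s - g t) \<le> 2 * R * \<sigma>" if "s \<in> {a..b}" "t \<in> {a..b}" for s t
    proof -
      have "g s \<in> cball x0 (R * \<sigma>)" "g t \<in> cball x0 (R * \<sigma>)"
        using g image_subset_iff[of g "{a..b}" "cball x0 (R / (2 * N))"] that by (simp_all add: \<sigma>_def)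
      then have "dist x0 (g s) \<le> R * \<sigma>" "dist x0 (g t) \<le> R * \<sigma>" by simp_all
      then have "dist (g s) (g t) \<le> R * \<sigma> + R * \<sigma>" by (rule dist_triangle3[THEN order_trans, OF add_mono])
      then show ?thesis by (simp add: dist_norm)
    qed
    show "2 * R * (l \<bullet> (g s - g t)) \<le> (norm (g s - g t))\<^sup>2"
      if "a \<le> s" "s \<le> t" "t < b" "norm l = 1" "l \<in> tangent_cone (g ` {t..b}) (g t)" for s t l
    proof (rule inner_le_of_notin_ball[OF that(4) R])
      have "g ` {a..t} \<inter> ball (g t + R *\<^sub>R l) R = {}"
        using g that unfolding R_path_def by auto
      moreover have "g s \<in> g ` {a..t}" using that by simp
      ultimately show "g s \<notin> ball (g t + R *\<^sub>R l) R" by blast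
    qed
  qed (use g R \<sigma> in \<open>auto simp: R_path_def\<close>)
  let ?K = "convex hull (g ` {a..b})"
  have length: "curve_length g a b \<le> ennreal (past_perimeter b / \<kappa>)"
    by (rule curve_length_le_past_perimeter[OF \<kappa>])
  have "compact (g ` {a..b})" by (intro compact_continuous_image cont compact_Icc)
  then have "cauchy_perimeter ?K = past_perimeter b"
    using a_less_b
    by (simp add: cauchy_perimeter_def past_perimeter_def support_convex_hull compact_imp_bounded)
  then have per: "ennreal (past_perimeter b) \<le> perimeter ?K"
    using cauchy_perimeter_le_perimeter[of ?K] \<open>compact _\<close> a_less_b
    by (simp add: compact_convex_hull)
  have "0 \<le> past_perimeter b"
    using mono_onD[OF mono_on_past_perimeter, of a b] past_perimeter_start a_less_b by simp
  then have "ennreal (past_perimeter b / \<kappa>) = ennreal (past_perimeter b) / ennreal \<kappa>"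
    using \<kappa> by (simp add: divide_ennreal)
  also have "\<dots> \<le> perimeter ?K / ennreal \<kappa>" by (rule divide_right_mono_ennreal[OF per])
  finally have "curve_length g a b \<le> perimeter ?K / ennreal \<kappa>" using length by (rule order_trans[rotated])
  moreover have "rectifiable_curve g a b"
    unfolding rectifiable_curve_def using cont length by (simp add: le_less_trans)
  moreover have "curve_length g t1 t2 / ennreal (dist (g t1) (g t2)) \<le> ennreal (2 * pi / \<kappa> * exp (2 * pi / \<kappa>))"
    if "a \<le> t1" "t1 < t2" "t2 \<le> b" for t1 t2
  proof -
    have "0 < dist (g t1) (g t2)" using g_neq[OF that] by simp
    have "curve_length g t1 t2 / ennreal (dist (g t1) (g t2))
        \<le> ennreal (2 * pi / \<kappa> * exp (2 * pi / \<kappa>) * dist (g t1) (g t2)) / ennreal (dist (g t1) (g t2))"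
      by (intro divide_right_mono_ennreal r_curve.curve_length_le_chord[OF restrict[OF that]] \<kappa>)
    also have "\<dots> = ennreal (2 * pi / \<kappa> * exp (2 * pi / \<kappa>))"
      using \<kappa> \<open>0 < dist _ _\<close> by (subst divide_ennreal) auto
    finally show ?thesis .
  qed
  ultimately show "rectifiable_curve g a b \<and>
      curve_length g a b \<le> perimeter (convex hull (g ` {a..b})) / ennreal (1 + cos (pi / 2 + 2 * arcsin (1 / (2 * N)))) \<and>
      (\<forall>t1 t2. a \<le> t1 \<and> t1 < t2 \<and> t2 \<le> b \<longrightarrow>
         curve_length g t1 t2 / ennreal (dist (g t1) (g t2))
           \<le> ennreal (2 * pi / (1 + cos (pi / 2 + 2 * arcsin (1 / (2 * N))))
               * exp (2 * pi / (1 + cos (pi / 2 + 2 * arcsin (1 / (2 * N)))))))"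
    unfolding \<kappa>_def by blast
qed

end
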